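(* Let $\mathbf{k}$ be a commutative ring. Let $Y$ be a subset of $\{1,2,3,\ldots\}$ that is closed under ternary addition (i.e., satisfies $y+z+w\in Y$ for every $y,z,w\in Y$). Let $T:=Y^*$ be the set of all compositions whose entries all belong to $Y$. Let $\mathrm{QSym}_T^{(1)}$ be the $\mathbf{k}$-submodule of $\mathrm{QSym}$ spanned by the family $\left(\eta_\alpha^{(1)}\right)_{\alpha\in T}$. Then $\mathrm{QSym}_T^{(1)}$ is a Hopf subalgebra of $\mathrm{QSym}$.
   Context: For an integer $m$, $[m]=\{1,2,\ldots,m\}$ (empty if $m\le 0$). A composition is a finite tuple $\alpha=(\alpha_1,\ldots,\alpha_k)$ of positive integers; its length is $\ell(\alpha)=k$, its size is $|\alpha|=\alpha_1+\cdots+\alpha_k$. $\mathrm{Comp}$ is the set of all compositions (including the empty one), and $\mathrm{Comp}_n$ the set of compositions of size $n$. For $\alpha=(\alpha_1,\ldots,\alpha_k)\in\mathrm{Comp}_n$ set $D(\alpha)=\{\alpha_1+\cdots+\alpha_i \mid i\in[k-1]\}\subseteq[n-1]$, and $\mathrm{rev}\,\alpha=(\alpha_k,\ldots,\alpha_1)$. $\beta\gamma$ denotes concatenation of compositions. $\mathrm{QSym}$ is the Hopf algebra of quasisymmetric functions over $\mathbf{k}$ (a $\mathbf{k}$-subalgebra of $\mathbf{k}[[x_1,x_2,\ldots]]$). It has the $\mathbf{k}$-basis $(M_\alpha)_{\alpha\in\mathrm{Comp}}$ with $M_\alpha=\sum_{i_1<i_2<\cdots<i_\ell}x_{i_1}^{\alpha_1}\cdots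 x_{i_\ell}^{\alpha_\ell}$ for $\alpha=(\alpha_1,\ldots,\alpha_\ell)$. Its coproduct is the $\mathbf{k}$-linear map with $\Delta(M_\alpha)=\sum_{\beta\gamma=\alpha}M_\beta\otimes M_\gamma$; its antipode is the $\mathbf{k}$-linear map with $S(M_\alpha)=(-1)^{\ell(\alpha)}\sum_{\gamma\in\mathrm{Comp}_n;\ D(\gamma)\subseteq D(\mathrm{rev}\,\alpha)}M_\gamma$ for $\alpha\in\mathrm{Comp}_n$. For $\alpha\in\mathrm{Comp}_n$, $\eta_\alpha^{(1)}=\sum_{\beta\in\mathrm{Comp}_n;\ D(\beta)\subseteq D(\alpha)}2^{\ell(\beta)}M_\beta\in\mathrm{QSym}$ (this is the case $q=1$, $r=q+1=2$ of the general family $\eta_\alpha^{(q)}=\sum_{\beta}r^{\ell(\beta)}M_\beta$ over the same $\beta$). Convention: a "subcoalgebra" of a $\mathbf{k}$-coalgebra $C$ means a $\mathbf{k}$-submodule $D$ of $C$ such that $\Delta(D)$ is contained in the image of the canonical map $D\otimes D\to C\otimes C$. A Hopf subalgebra is a $\mathbf{k}$-subalgebra (containing $1$) that is a subcoalgebra in this sense and is mapped into itself by the antipode. *)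

theory Defs
  imports Complex_Main "HOL-Library.Poly_Mapping"
begin

section \<open>Formal power series in countably many variables\<close>

text \<open>
  A monomial is a finitely supported exponent vector of type \<^typ>\<open>nat \<Rightarrow>\<^sub>0 nat\<close>.  The variables
  are indexed by all of \<^typ>\<open>nat\<close>, so index \<open>i\<close> stands for the variable usually called
  \<open>x\<^bsub>i+1\<^esub>\<close>; only the order type of the index set matters.
\<close>

typedef 'k mfps = "UNIV :: ((nat \<Rightarrow>\<^sub>0 nat) \<Rightarrow> 'k) set"
  morphisms mcoeff Abs_mfps ..

lemma mcoeff_Abs [simp]: "mcoeff (Abs_mfps f) = f"
  by (simp add: Abs_mfps_inverse)

lemma mfps_eqI: "(\<And>m. mcoeff f m = mcoeff g m) \<Longrightarrow> f = g"
  by (metis ext mcoeff_inject)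

definition splits :: "(nat \<Rightarrow>\<^sub>0 nat) \<Rightarrow> ((nat \<Rightarrow>\<^sub>0 nat) \<times> (nat \<Rightarrow>\<^sub>0 nat)) set" where
  "splits m = {(p, q). p + q = m}"

lemma finite_splits [simp]: "finite (splits m)"
proof -
  let ?A = "{p. \<exists>q. p + q = m}"
  let ?K = "Poly_Mapping.keys m"
  let ?F = "{f. \<forall>x. (x \<in> ?K \<longrightarrow> f x \<in> {0..sum (Poly_Mapping.lookup m) ?K}) \<and> (x \<notin> ?K \<longrightarrow> f x = 0)}"
  have "Poly_Mapping.lookup p \<in> ?F" if "p \<in> ?A" for p
  proof -
    from that obtain q where q: "m = p + q" by auto
    have le: "Poly_Mapping.lookup p x \<le> Poly_Mapping.lookup m x" for x by (simp add: q lookup_add)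
    have "Poly_Mapping.lookup m x \<le> sum (Poly_Mapping.lookup m) ?K" if "x \<in> ?K" for x
      by (rule member_le_sum) (use that in auto)
    moreover have "Poly_Mapping.lookup p x = 0" if "x \<notin> ?K" for x
      using le[of x] that by (simp add: in_keys_iff)
    ultimately show ?thesis using le by (auto intro: order_trans)
  qed
  then have "Poly_Mapping.lookup ` ?A \<subseteq> ?F" by (rule image_subsetI)
  moreover have "finite ?F" by (rule finite_set_of_finite_funs) auto
  ultimately have "finite (Poly_Mapping.lookup ` ?A)" by (rule finite_subset)
  then have "finite ?A"
    by (rule finite_imageD) (simp add: inj_on_def)
  moreover have "splits m \<subseteq> ?A \<times> ?A"
    by (auto simp: splits_def intro: add.commute)
  ultimately show ?thesis by (meson finite_SigmaI finite_subset)
qed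

instantiation mfps :: (comm_ring_1) comm_ring_1
begin

definition zero_mfps_def: "0 = Abs_mfps (\<lambda>m. 0)"
definition one_mfps_def: "1 = Abs_mfps (\<lambda>m. if m = 0 then 1 else 0)"
definition plus_mfps_def: "f + g = Abs_mfps (\<lambda>m. mcoeff f m + mcoeff g m)"
definition minus_mfps_def: "f - g = Abs_mfps (\<lambda>m. mcoeff f m - mcoeff g m)"
definition uminus_mfps_def: "- f = Abs_mfps (\<lambda>m. - mcoeff f m)"
definition times_mfps_def:
  "f * g = Abs_mfps (\<lambda>m. \<Sum>(p, q)\<in>splits m. mcoeff f p * mcoeff g q)"

instance
proof
  fix f g h :: "'a mfps"
  show "f * g * h = f * (g * h)"
  proof (rule mfps_eqI)
    fix m
    have "mcoeff (f * g * h) m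
        = (\<Sum>((s, r), (p, q))\<in>Sigma (splits m) (\<lambda>(s, r). splits s).
             mcoeff f p * mcoeff g q * mcoeff h r)"
      by (simp add: times_mfps_def sum_distrib_right case_prod_unfold sum.Sigma)
    also have "\<dots> = (\<Sum>((p, s), (q, r))\<in>Sigma (splits m) (\<lambda>(p, s). splits s).
             mcoeff f p * mcoeff g q * mcoeff h r)"
      by (rule sum.reindex_bij_witness
          [where i = "\<lambda>((p, s), (q, r)). ((p + q, r), (p, q))"
             and j = "\<lambda>((s, r), (p, q)). ((p, q + r), (q, r))"])
         (auto simp: splits_def add.assoc)
    also have "\<dots> = mcoeff (f * (g * h)) m"
      by (simp add: times_mfps_def sum_distrib_left case_prod_unfold sum.Sigma mult.assoc)
    finally show "mcoeff (f * g * h) m = mcoeff (f * (g * h)) m" .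
  qed
  show "f * g = g * f"
  proof (rule mfps_eqI)
    fix m
    show "mcoeff (f * g) m = mcoeff (g * f) m"
      unfolding times_mfps_def mcoeff_Abs
      by (rule sum.reindex_bij_witness[where i = "\<lambda>(p, q). (q, p)" and j = "\<lambda>(p, q). (q, p)"])
         (auto simp: splits_def add.commute mult.commute)
  qed
  show "1 * f = f"
  proof (rule mfps_eqI)
    fix m
    have "mcoeff (1 * f) m = (\<Sum>x\<in>splits m. if x = (0, m) then mcoeff f m else 0)"
      unfolding times_mfps_def one_mfps_def mcoeff_Abs
      by (rule sum.cong) (auto simp: splits_def split: if_splits)
    also have "\<dots> = mcoeff f m"
      by (simp add: sum.delta) (simp add: splits_def)
    finally show "mcoeff (1 * f) m = mcoeff f m" .
  qed
  show "(f + g) * h = f * h + g * h"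
    by (rule mfps_eqI)
       (simp add: times_mfps_def plus_mfps_def distrib_right case_prod_unfold sum.distrib)
  show "(0 :: 'a mfps) \<noteq> 1"
  proof
    assume "(0 :: 'a mfps) = 1"
    then have "mcoeff (0 :: 'a mfps) 0 = mcoeff 1 0" by simp
    then show False by (simp add: zero_mfps_def one_mfps_def)
  qed
qed (auto intro!: mfps_eqI
       simp: zero_mfps_def plus_mfps_def minus_mfps_def uminus_mfps_def add_ac)

end

lemma mcoeff_simps [simp]:
  "mcoeff 0 m = 0"
  "mcoeff (f + g) m = mcoeff f m + mcoeff g m"
  "mcoeff (f - g) m = mcoeff f m - mcoeff g m"
  "mcoeff (- f) m = - mcoeff f m"
  by (simp_all add: zero_mfps_def plus_mfps_def minus_mfps_def uminus_mfps_def)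

lemma mcoeff_sum [simp]: "mcoeff (sum g A) m = (\<Sum>a\<in>A. mcoeff (g a) m)"
  by (induction A rule: infinite_finite_induct) auto

definition mfps_scale :: "'k::comm_ring_1 \<Rightarrow> 'k mfps \<Rightarrow> 'k mfps" where
  "mfps_scale c f = Abs_mfps (\<lambda>m. c * mcoeff f m)"

lemma mcoeff_scale [simp]: "mcoeff (mfps_scale c f) m = c * mcoeff f m"
  by (simp add: mfps_scale_def)

interpretation mfps: module mfps_scale
  by unfold_locales (auto intro!: mfps_eqI simp: algebra_simps)


section \<open>Tensor products\<close>

text \<open>
  The free \<open>k\<close>-module on the pairs of power series consists of the finitely supported functions
  of type \<^typ>\<open>('k mfps \<times> 'k mfps) \<Rightarrow>\<^sub>0 'k\<close>.  For a submodule \<open>C\<close> of \<open>k[[x]]\<close>, the tensor product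
  \<open>C \<otimes> C\<close> is the free module on \<open>C \<times> C\<close> modulo the bilinearity relations with entries in \<open>C\<close>; its
  elements are represented as cosets.  It is important that the relations only involve elements
  of \<open>C\<close>, since a tensor vanishing in \<open>C \<otimes> C\<close> need not vanish in \<open>D \<otimes> D\<close> for a submodule \<open>D\<close>.
\<close>

type_synonym 'k free_pairs = "('k mfps \<times> 'k mfps) \<Rightarrow>\<^sub>0 'k"

definition free_scale :: "'k::comm_ring_1 \<Rightarrow> 'k free_pairs \<Rightarrow> 'k free_pairs" where
  "free_scale c u = Poly_Mapping.map ((*) c) u"

lemma lookup_free_scale [simp]: "Poly_Mapping.lookup (free_scale c u) x = c * Poly_Mapping.lookup u x"
  by (simp add: free_scale_def Poly_Mapping.map.rep_eq when_def)

interpretation free: module free_scale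
  by unfold_locales (auto intro!: poly_mapping_eqI simp: lookup_add algebra_simps)

abbreviation pair_gen :: "'k::comm_ring_1 mfps \<Rightarrow> 'k mfps \<Rightarrow> 'k free_pairs" where
  "pair_gen a b \<equiv> Poly_Mapping.single (a, b) 1"

definition bilinear_rels :: "'k::comm_ring_1 mfps set \<Rightarrow> 'k free_pairs set" where
  "bilinear_rels C =
     {pair_gen (a + a') b - pair_gen a b - pair_gen a' b | a a' b. a \<in> C \<and> a' \<in> C \<and> b \<in> C} \<union>
     {pair_gen a (b + b') - pair_gen a b - pair_gen a b' | a b b'. a \<in> C \<and> b \<in> C \<and> b' \<in> C} \<union>
     {pair_gen (mfps_scale c a) b - free_scale c (pair_gen a b) | c a b. a \<in> C \<and> b \<in> C} \<union>
     {pair_gen a (mfps_scale c b) - free_scale c (pair_gen a b) | c a b. a \<in> C \<and> b \<in> C}"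

definition tensor_class :: "'k::comm_ring_1 mfps set \<Rightarrow> 'k free_pairs \<Rightarrow> 'k free_pairs set" where
  "tensor_class C u = {v. v - u \<in> free.span (bilinear_rels C)}"

definition tensor_square :: "'k::comm_ring_1 mfps set \<Rightarrow> 'k free_pairs set set" where
  "tensor_square C = tensor_class C ` {u. Poly_Mapping.keys u \<subseteq> C \<times> C}"

text \<open>The canonical map \<open>D \<otimes> D \<rightarrow> C \<otimes> C\<close> for \<open>D \<subseteq> C\<close>, sending the class of \<open>u\<close> to the class of \<open>u\<close>.\<close>

definition tensor_incl ::
    "'k::comm_ring_1 mfps set \<Rightarrow> 'k free_pairs set \<Rightarrow> 'k free_pairs set" where
  "tensor_incl C X = (\<Union>u\<in>X. tensor_class C u)"

lemma bilinear_rels_mono: "D \<subseteq> C \<Longrightarrow> bilinear_rels D \<subseteq> bilinear_rels C"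
  unfolding bilinear_rels_def by blast

lemma tensor_class_eq_iff:
  "tensor_class C u = tensor_class C v \<longleftrightarrow> u - v \<in> free.span (bilinear_rels C)"
proof
  assume "tensor_class C u = tensor_class C v"
  moreover have "u \<in> tensor_class C u" by (simp add: tensor_class_def free.span_zero)
  ultimately show "u - v \<in> free.span (bilinear_rels C)" by (auto simp: tensor_class_def)
next
  assume *: "u - v \<in> free.span (bilinear_rels C)"
  have "w - u \<in> free.span (bilinear_rels C) \<longleftrightarrow> w - v \<in> free.span (bilinear_rels C)" for w
    using free.span_add[OF _ *, of "w - u"] free.span_diff[OF _ *, of "w - v"] by auto
  then show "tensor_class C u = tensor_class C v" by (simp add: tensor_class_def)
qed

lemma tensor_incl_class:
  assumes "D \<subseteq> C"
  shows "tensor_incl C (tensor_class D u) = tensor_class C u"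
proof -
  have "tensor_class C v = tensor_class C u" if "v \<in> tensor_class D u" for v
    using that free.span_mono[OF bilinear_rels_mono[OF assms]]
    by (auto simp: tensor_class_eq_iff tensor_class_def[of D])
  moreover have "u \<in> tensor_class D u" by (simp add: tensor_class_def free.span_zero)
  ultimately show ?thesis unfolding tensor_incl_def by blast
qed


section \<open>Compositions\<close>

definition Comp :: "nat list set" where
  "Comp = {\<alpha>. \<forall>a\<in>set \<alpha>. 0 < a}"

definition Comp_of :: "nat \<Rightarrow> nat list set" where
  "Comp_of n = {\<alpha> \<in> Comp. sum_list \<alpha> = n}"

definition partial_sums :: "nat list \<Rightarrow> nat set" where
  "partial_sums \<alpha> = {sum_list (take i \<alpha>) | i. 1 \<le> i \<and> i < length \<alpha>}"

lemma length_le_sum_list: "\<alpha> \<in> Comp \<Longrightarrow> length \<alpha> \<le> sum_list \<alpha>"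
  by (induction \<alpha>) (auto simp: Comp_def Suc_le_eq)

lemma finite_Comp_le: "finite {\<alpha> \<in> Comp. sum_list \<alpha> \<le> n}"
proof (rule finite_subset)
  show "{\<alpha> \<in> Comp. sum_list \<alpha> \<le> n} \<subseteq> {xs. set xs \<subseteq> {..n} \<and> length xs \<le> n}"
    using length_le_sum_list member_le_sum_list by (fastforce intro: order_trans)
qed (rule finite_lists_length_le, simp)

lemma finite_Comp_of [simp]: "finite (Comp_of n)"
  by (rule finite_subset[OF _ finite_Comp_le[of n]]) (auto simp: Comp_of_def)


section \<open>Quasisymmetric functions\<close>

text \<open>The monomial \<open>x\<^bsub>i1\<^esub>^\<alpha>1 \<cdots> x\<^bsub>ik\<^esub>^\<alpha>k\<close>.\<close>

definition monomial :: "nat list \<Rightarrow> nat list \<Rightarrow> (nat \<Rightarrow>\<^sub>0 nat)" where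
  "monomial is \<alpha> = (\<Sum>j<length \<alpha>. Poly_Mapping.single (is ! j) (\<alpha> ! j))"

definition increasing_tuples :: "nat \<Rightarrow> nat list set" where
  "increasing_tuples k = {is. length is = k \<and> sorted_wrt (<) is}"

definition mdegree :: "(nat \<Rightarrow>\<^sub>0 nat) \<Rightarrow> nat" where
  "mdegree m = (\<Sum>i\<in>Poly_Mapping.keys m. Poly_Mapping.lookup m i)"

definition QSym :: "'k::comm_ring_1 mfps set" where
  "QSym = {f. (\<exists>d. \<forall>m. mcoeff f m \<noteq> 0 \<longrightarrow> mdegree m \<le> d) \<and>
              (\<forall>\<alpha>\<in>Comp. \<forall>is\<in>increasing_tuples (length \<alpha>). \<forall>js\<in>increasing_tuples (length \<alpha>).
                 mcoeff f (monomial is \<alpha>) = mcoeff f (monomial js \<alpha>))}"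

text \<open>
  The coefficient of \<open>m\<close> in the infinite sum defining \<open>M\<^sub>\<alpha>\<close> counts the index tuples contributing
  the monomial \<open>m\<close>; for \<open>\<alpha> \<in> Comp\<close> there is at most one.
\<close>

definition M :: "nat list \<Rightarrow> 'k::comm_ring_1 mfps" where
  "M \<alpha> = Abs_mfps (\<lambda>m. of_nat (card {is \<in> increasing_tuples (length \<alpha>). monomial is \<alpha> = m}))"

text \<open>The coefficient of \<open>f \<in> QSym\<close> at \<open>M\<^sub>\<alpha>\<close>.\<close>

definition M_coeff :: "'k::comm_ring_1 mfps \<Rightarrow> nat list \<Rightarrow> 'k" where
  "M_coeff f \<alpha> = mcoeff f (monomial [0..<length \<alpha>] \<alpha>)"

text \<open>
  The linear extension to \<open>QSym\<close> of a map \<open>g\<close> given on the basis \<open>(M\<^sub>\<alpha>)\<close>, where \<open>scale\<close> is the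
  scalar multiplication of the target module.
\<close>

definition extend_linearly ::
    "('k::comm_ring_1 \<Rightarrow> 'b::ab_group_add \<Rightarrow> 'b) \<Rightarrow> (nat list \<Rightarrow> 'b) \<Rightarrow> 'k mfps \<Rightarrow> 'b" where
  "extend_linearly scale g f = (\<Sum>\<alpha> | \<alpha> \<in> Comp \<and> M_coeff f \<alpha> \<noteq> 0. scale (M_coeff f \<alpha>) (g \<alpha>))"

lemma increasing_tuples_nth_less:
  "is \<in> increasing_tuples k \<Longrightarrow> i < j \<Longrightarrow> j < k \<Longrightarrow> is ! i < is ! j"
  by (auto simp: increasing_tuples_def sorted_wrt_iff_nth_less)

lemma increasing_tuples_nth_eq:
  "is \<in> increasing_tuples k \<Longrightarrow> i < k \<Longrightarrow> j < k \<Longrightarrow> is ! i = is ! j \<longleftrightarrow> i = j"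
  using increasing_tuples_nth_less by (metis less_irrefl linorder_neqE_nat)

lemma lookup_monomial:
  assumes "is \<in> increasing_tuples (length \<alpha>)" "j < length \<alpha>"
  shows "Poly_Mapping.lookup (monomial is \<alpha>) (is ! j) = \<alpha> ! j"
proof -
  have "Poly_Mapping.lookup (monomial is \<alpha>) (is ! j)
      = (\<Sum>i<length \<alpha>. if i = j then \<alpha> ! i else 0)"
    unfolding monomial_def lookup_sum
    by (rule sum.cong) (use assms in \<open>auto simp: lookup_single when_def increasing_tuples_nth_eq\<close>)
  then show ?thesis using assms(2) by simp
qed

lemma keys_monomial:
  assumes "is \<in> increasing_tuples (length \<alpha>)" "\<alpha> \<in> Comp"
  shows "Poly_Mapping.keys (monomial is \<alpha>) = set is"
proof (intro equalityI subsetI)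
  fix x assume "x \<in> set is"
  then obtain j where j: "j < length \<alpha>" "x = is ! j"
    using assms(1) by (auto simp: increasing_tuples_def in_set_conv_nth)
  have "0 < \<alpha> ! j" using assms(2) j(1) by (auto simp: Comp_def)
  then show "x \<in> Poly_Mapping.keys (monomial is \<alpha>)"
    using lookup_monomial[OF assms(1) j(1)] j(2) by (simp add: in_keys_iff)
next
  fix x assume "x \<in> Poly_Mapping.keys (monomial is \<alpha>)"
  then have "(\<Sum>i<length \<alpha>. Poly_Mapping.lookup (Poly_Mapping.single (is ! i) (\<alpha> ! i)) x) \<noteq> 0"
    by (simp add: in_keys_iff monomial_def lookup_sum)
  then obtain i where "i < length \<alpha>" "is ! i = x"
    by (metis (no_types, lifting) lessThan_iff lookup_single_not_eq sum.neutral)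
  then show "x \<in> set is"
    using assms(1) by (auto simp: increasing_tuples_def)
qed

lemma monomial_eq_iff:
  assumes "is \<in> increasing_tuples (length \<alpha>)" "\<alpha> \<in> Comp"
    and "js \<in> increasing_tuples (length \<beta>)" "\<beta> \<in> Comp"
  shows "monomial is \<alpha> = monomial js \<beta> \<longleftrightarrow> is = js \<and> \<alpha> = \<beta>"
proof
  assume eq: "monomial is \<alpha> = monomial js \<beta>"
  then have "set is = set js"
    using keys_monomial assms by metis
  then have ij: "is = js"
    using assms(1,3) by (auto simp: increasing_tuples_def intro: strict_sorted_equal)
  have "length \<alpha> = length \<beta>"
    using assms(1,3) ij by (auto simp: increasing_tuples_def)
  then have "\<alpha> = \<beta>"
    using lookup_monomial[OF assms(1)] lookup_monomial[OF assms(3)] eq ij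
    by (auto intro: nth_equalityI)
  with ij show "is = js \<and> \<alpha> = \<beta>" by simp
qed simp

lemma mcoeff_M_monomial:
  assumes "\<alpha> \<in> Comp" "\<beta> \<in> Comp" "is \<in> increasing_tuples (length \<beta>)"
  shows "mcoeff (M \<alpha>) (monomial is \<beta>) = (if \<alpha> = \<beta> then 1 else 0)"
proof -
  have "{js \<in> increasing_tuples (length \<alpha>). monomial js \<alpha> = monomial is \<beta>}
      = (if \<alpha> = \<beta> then {is} else {})"
    using assms by (auto simp: monomial_eq_iff)
  then show ?thesis by (simp add: M_def)
qed

lemma upt_increasing [simp]: "[0..<k] \<in> increasing_tuples k"
  by (simp add: increasing_tuples_def)

lemma M_coeff_M: "\<alpha> \<in> Comp \<Longrightarrow> \<beta> \<in> Comp \<Longrightarrow> M_coeff (M \<alpha>) \<beta> = (if \<alpha> = \<beta> then 1 else 0)"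
  by (simp add: M_coeff_def mcoeff_M_monomial)

lemma mdegree_monomial:
  assumes "is \<in> increasing_tuples (length \<alpha>)" "\<alpha> \<in> Comp"
  shows "mdegree (monomial is \<alpha>) = sum_list \<alpha>"
proof -
  have "set is = (!) is ` {..<length \<alpha>}"
    using assms(1) by (auto simp: increasing_tuples_def in_set_conv_nth)
  moreover have "inj_on ((!) is) {..<length \<alpha>}"
    using increasing_tuples_nth_eq[OF assms(1)] by (auto simp: inj_on_def)
  ultimately have "mdegree (monomial is \<alpha>)
      = (\<Sum>j<length \<alpha>. Poly_Mapping.lookup (monomial is \<alpha>) (is ! j))"
    by (simp add: mdegree_def keys_monomial[OF assms] sum.reindex)
  also have "\<dots> = sum_list \<alpha>"
    by (simp add: lookup_monomial[OF assms(1)] sum_list_sum_nth atLeast0LessThan)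
  finally show ?thesis .
qed

lemma monomial_exhaust:
  obtains "is" \<alpha> where "\<alpha> \<in> Comp" "is \<in> increasing_tuples (length \<alpha>)" "m = monomial is \<alpha>"
proof -
  define xs where "xs = sorted_list_of_set (Poly_Mapping.keys m)"
  define \<alpha> where "\<alpha> = map (Poly_Mapping.lookup m) xs"
  have set_xs: "set xs = Poly_Mapping.keys m" by (simp add: xs_def)
  have inc: "xs \<in> increasing_tuples (length \<alpha>)"
    by (simp add: increasing_tuples_def \<alpha>_def xs_def)
  have comp: "\<alpha> \<in> Comp"
    by (auto simp: Comp_def \<alpha>_def set_xs in_keys_iff)
  have "m = monomial xs \<alpha>"
  proof (rule poly_mapping_eqI)
    fix x
    show "Poly_Mapping.lookup m x = Poly_Mapping.lookup (monomial xs \<alpha>) x"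
    proof (cases "x \<in> set xs")
      case True
      then obtain j where "j < length xs" "x = xs ! j" by (auto simp: in_set_conv_nth)
      then show ?thesis using lookup_monomial[OF inc, of j] by (simp add: \<alpha>_def)
    next
      case False
      then show ?thesis
        using keys_monomial[OF inc comp] set_xs by (auto simp: in_keys_iff)
    qed
  qed
  with comp inc that show thesis by blast
qed

lemma M_in_QSym:
  assumes "\<alpha> \<in> Comp"
  shows "M \<alpha> \<in> QSym"
proof -
  have "mdegree m \<le> sum_list \<alpha>" if "mcoeff (M \<alpha> :: 'a mfps) m \<noteq> 0" for m
  proof -
    obtain "is" \<beta> where m: "\<beta> \<in> Comp" "is \<in> increasing_tuples (length \<beta>)" "m = monomial is \<beta>"
      by (rule monomial_exhaust)
    with that assms have "\<alpha> = \<beta>" by (auto simp: mcoeff_M_monomial split: if_splits)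
    then show ?thesis using m mdegree_monomial by auto
  qed
  then show ?thesis
    using assms by (auto simp: QSym_def mcoeff_M_monomial)
qed

lemma subspace_QSym: "mfps.subspace QSym"
proof (rule mfps.subspaceI)
  fix f g :: "'a mfps" assume f: "f \<in> QSym" and g: "g \<in> QSym"
  from f obtain d where d: "\<And>m. mcoeff f m \<noteq> 0 \<Longrightarrow> mdegree m \<le> d" by (auto simp: QSym_def)
  from g obtain e where e: "\<And>m. mcoeff g m \<noteq> 0 \<Longrightarrow> mdegree m \<le> e" by (auto simp: QSym_def)
  have "mdegree m \<le> max d e" if "mcoeff (f + g) m \<noteq> 0" for m
    using d[of m] e[of m] that by fastforce
  then have "\<exists>d. \<forall>m. mcoeff (f + g) m \<noteq> 0 \<longrightarrow> mdegree m \<le> d" by blast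
  moreover have "mcoeff (f + g) (monomial is \<alpha>) = mcoeff (f + g) (monomial js \<alpha>)"
    if "\<alpha> \<in> Comp" "is \<in> increasing_tuples (length \<alpha>)" "js \<in> increasing_tuples (length \<alpha>)"
    for \<alpha> "is" js
    using f g that unfolding QSym_def mcoeff_simps mem_Collect_eq by metis
  ultimately show "f + g \<in> QSym" unfolding QSym_def by blast
next
  fix c and f :: "'a mfps" assume f: "f \<in> QSym"
  then have "\<exists>d. \<forall>m. mcoeff (mfps_scale c f) m \<noteq> 0 \<longrightarrow> mdegree m \<le> d"
    by (auto simp: QSym_def) (metis mult_zero_right)
  moreover have "mcoeff (mfps_scale c f) (monomial is \<alpha>) = mcoeff (mfps_scale c f) (monomial js \<alpha>)"
    if "\<alpha> \<in> Comp" "is \<in> increasing_tuples (length \<alpha>)" "js \<in> increasing_tuples (length \<alpha>)"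
    for \<alpha> "is" js
    using f that unfolding QSym_def mcoeff_scale mem_Collect_eq by metis
  ultimately show "mfps_scale c f \<in> QSym" unfolding QSym_def by blast
qed (simp add: QSym_def)

lemma finite_M_coeff_support:
  assumes "f \<in> QSym"
  shows "finite {\<alpha> \<in> Comp. M_coeff f \<alpha> \<noteq> 0}"
proof -
  from assms obtain d where d: "\<And>m. mcoeff f m \<noteq> 0 \<Longrightarrow> mdegree m \<le> d" by (auto simp: QSym_def)
  have "sum_list \<alpha> \<le> d" if "\<alpha> \<in> Comp" "M_coeff f \<alpha> \<noteq> 0" for \<alpha>
    using d[of "monomial [0..<length \<alpha>] \<alpha>"] that by (simp add: M_coeff_def mdegree_monomial)
  then show ?thesis by (intro finite_subset[OF _ finite_Comp_le[of d]]) auto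
qed

lemma QSym_expansion:
  assumes "f \<in> QSym"
  shows "f = (\<Sum>\<alpha> | \<alpha> \<in> Comp \<and> M_coeff f \<alpha> \<noteq> 0. mfps_scale (M_coeff f \<alpha>) (M \<alpha>))"
    (is "f = ?g")
proof (rule mfps_eqI)
  fix m
  let ?S = "{\<alpha> \<in> Comp. M_coeff f \<alpha> \<noteq> 0}"
  obtain "is" \<beta> where m: "\<beta> \<in> Comp" "is \<in> increasing_tuples (length \<beta>)" "m = monomial is \<beta>"
    by (rule monomial_exhaust)
  have "mcoeff ?g m = (\<Sum>\<alpha>\<in>?S. if \<alpha> = \<beta> then M_coeff f \<alpha> else 0)"
    unfolding mcoeff_sum by (rule sum.cong) (use m in \<open>auto simp: mcoeff_M_monomial\<close>)
  also have "\<dots> = M_coeff f \<beta>"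
    by (subst sum.delta[OF finite_M_coeff_support[OF assms]]) (use m(1) in auto)
  also have "\<dots> = mcoeff f m"
    using assms m upt_increasing[of "length \<beta>"] unfolding QSym_def M_coeff_def by blast
  finally show "mcoeff f m = mcoeff ?g m" by (rule sym)
qed

lemma QSym_eq_span: "QSym = mfps.span (M ` Comp)"
proof (intro equalityI subsetI)
  fix f :: "'a mfps" assume "f \<in> QSym"
  then have "f = (\<Sum>\<alpha> | \<alpha> \<in> Comp \<and> M_coeff f \<alpha> \<noteq> 0. mfps_scale (M_coeff f \<alpha>) (M \<alpha>))"
    by (rule QSym_expansion)
  also have "\<dots> \<in> mfps.span (M ` Comp)"
    by (intro mfps.span_sum mfps.span_scale mfps.span_base) auto
  finally show "f \<in> mfps.span (M ` Comp)" .
next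
  fix f :: "'a mfps" assume "f \<in> mfps.span (M ` Comp)"
  moreover have "mfps.span (M ` Comp) \<subseteq> (QSym :: 'a mfps set)"
    by (rule mfps.span_minimal[OF _ subspace_QSym]) (auto intro: M_in_QSym)
  ultimately show "f \<in> QSym" by (rule subsetD[rotated])
qed

lemma extend_linearly_superset:
  assumes "module scale" "finite A" "A \<subseteq> Comp" "{\<alpha> \<in> Comp. M_coeff f \<alpha> \<noteq> 0} \<subseteq> A"
  shows "extend_linearly scale g f = (\<Sum>\<alpha>\<in>A. scale (M_coeff f \<alpha>) (g \<alpha>))"
  unfolding extend_linearly_def
  by (rule sum.mono_neutral_left) (use assms in \<open>auto simp: module.scale_zero_left[OF assms(1)]\<close>)

lemma extend_linearly_M:
  fixes scale :: "'a::comm_ring_1 \<Rightarrow> 'b::ab_group_add \<Rightarrow> 'b"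
  assumes "module scale" "\<alpha> \<in> Comp"
  shows "extend_linearly scale g (M \<alpha>) = g \<alpha>"
proof -
  have "{\<beta> \<in> Comp. M_coeff (M \<alpha> :: 'a mfps) \<beta> \<noteq> 0} \<subseteq> {\<alpha>}"
    using assms(2) by (auto simp: M_coeff_M split: if_splits)
  then show ?thesis
    using extend_linearly_superset[OF assms(1), of "{\<alpha>}" "M \<alpha>" g] assms(2)
    by (simp add: M_coeff_M module.scale_one[OF assms(1)])
qed

lemma extend_linearly_add:
  assumes "module scale" "f \<in> QSym" "g \<in> QSym"
  shows "extend_linearly scale h (f + g) = extend_linearly scale h f + extend_linearly scale h g"
proof -
  define A where "A = {\<alpha> \<in> Comp. M_coeff f \<alpha> \<noteq> 0} \<union> {\<alpha> \<in> Comp. M_coeff g \<alpha> \<noteq> 0}"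
  have A: "finite A" "A \<subseteq> Comp"
    using finite_M_coeff_support assms(2,3) by (auto simp: A_def)
  have add: "M_coeff (f + g) \<alpha> = M_coeff f \<alpha> + M_coeff g \<alpha>" for \<alpha> by (simp add: M_coeff_def)
  have "{\<alpha> \<in> Comp. M_coeff (f + g) \<alpha> \<noteq> 0} \<subseteq> A" by (auto simp: A_def add)
  then show ?thesis
    using A extend_linearly_superset[OF assms(1) A, of _ h]
    by (simp add: A_def add module.scale_left_distrib[OF assms(1)] sum.distrib)
qed

lemma extend_linearly_scale:
  assumes "module scale" "f \<in> QSym"
  shows "extend_linearly scale h (mfps_scale c f) = scale c (extend_linearly scale h f)"
proof -
  define A where "A = {\<alpha> \<in> Comp. M_coeff f \<alpha> \<noteq> 0}"
  have A: "finite A" "A \<subseteq> Comp"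
    using finite_M_coeff_support assms(2) by (auto simp: A_def)
  have eq: "M_coeff (mfps_scale c f) \<alpha> = c * M_coeff f \<alpha>" for \<alpha> by (simp add: M_coeff_def)
  have "{\<alpha> \<in> Comp. M_coeff (mfps_scale c f) \<alpha> \<noteq> 0} \<subseteq> A" by (auto simp: A_def eq)
  then show ?thesis
    using extend_linearly_superset[OF assms(1) A, of _ h]
    by (simp add: A_def eq module.scale_scale[OF assms(1), symmetric]
          module.scale_sum_right[OF assms(1)])
qed

definition coproduct_rep :: "'k::comm_ring_1 mfps \<Rightarrow> 'k free_pairs" where
  "coproduct_rep =
     extend_linearly free_scale (\<lambda>\<alpha>. \<Sum>(\<beta>, \<gamma>) | \<beta> @ \<gamma> = \<alpha>. pair_gen (M \<beta>) (M \<gamma>))"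

definition coproduct :: "'k::comm_ring_1 mfps \<Rightarrow> 'k free_pairs set" where
  "coproduct f = tensor_class QSym (coproduct_rep f)"

definition antipode :: "'k::comm_ring_1 mfps \<Rightarrow> 'k mfps" where
  "antipode =
     extend_linearly mfps_scale
       (\<lambda>\<alpha>. mfps_scale ((- 1) ^ length \<alpha>)
              (\<Sum>\<gamma> | \<gamma> \<in> Comp_of (sum_list \<alpha>) \<and> partial_sums \<gamma> \<subseteq> partial_sums (rev \<alpha>). M \<gamma>))"

lemma finite_deconcatenations [simp]: "finite {(\<beta>, \<gamma>). \<beta> @ \<gamma> = (\<alpha> :: nat list)}"
proof (rule finite_subset)
  show "{(\<beta>, \<gamma>). \<beta> @ \<gamma> = \<alpha>} \<subseteq> (\<lambda>i. (take i \<alpha>, drop i \<alpha>)) ` {..length \<alpha>}"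
  proof
    fix p assume "p \<in> {(\<beta>, \<gamma>). \<beta> @ \<gamma> = \<alpha>}"
    then have "p = (take (length (fst p)) \<alpha>, drop (length (fst p)) \<alpha>)"
      and "length (fst p) \<le> length \<alpha>" by auto
    then show "p \<in> (\<lambda>i. (take i \<alpha>, drop i \<alpha>)) ` {..length \<alpha>}" by blast
  qed
qed simp

lemma coproduct_M:
  assumes "\<alpha> \<in> Comp"
  shows "coproduct (M \<alpha>) = tensor_class QSym (\<Sum>(\<beta>, \<gamma>) | \<beta> @ \<gamma> = \<alpha>. pair_gen (M \<beta>) (M \<gamma>))"
  unfolding coproduct_def coproduct_rep_def
  by (simp add: extend_linearly_M[OF free.module_axioms assms])

lemma coproduct_in_tensor_square:
  assumes "f \<in> QSym"
  shows "coproduct f \<in> tensor_square QSym"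
proof -
  let ?P = "{u. Poly_Mapping.keys u \<subseteq> QSym \<times> QSym} :: 'a free_pairs set"
  have sub: "free.subspace ?P"
  proof (rule free.subspaceI)
    show "u + v \<in> ?P" if "u \<in> ?P" "v \<in> ?P" for u v
      using that keys_add[of u v] by blast
    show "free_scale c u \<in> ?P" if "u \<in> ?P" for c u
    proof -
      have "Poly_Mapping.keys (free_scale c u) \<subseteq> Poly_Mapping.keys u"
        by (auto simp: in_keys_iff)
      then show ?thesis using that by blast
    qed
  qed simp
  have "(case p of (\<beta>, \<gamma>) \<Rightarrow> pair_gen (M \<beta>) (M \<gamma>)) \<in> ?P"
    if "\<alpha> \<in> Comp" "p \<in> {(\<beta>, \<gamma>). \<beta> @ \<gamma> = \<alpha>}" for \<alpha> p
    using that by (auto simp: Comp_def intro!: M_in_QSym)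
  then have "coproduct_rep f \<in> ?P"
    unfolding coproduct_rep_def extend_linearly_def
    by (intro free.subspace_sum[OF sub] free.subspace_scale[OF sub]) blast
  then show ?thesis by (auto simp: coproduct_def tensor_square_def)
qed

lemma antipode_M:
  assumes "\<alpha> \<in> Comp"
  shows "antipode (M \<alpha>) = mfps_scale ((- 1) ^ length \<alpha>)
    (\<Sum>\<gamma> | \<gamma> \<in> Comp_of (sum_list \<alpha>) \<and> partial_sums \<gamma> \<subseteq> partial_sums (rev \<alpha>). M \<gamma>)"
  unfolding antipode_def by (simp add: extend_linearly_M[OF mfps.module_axioms assms])

definition subcoalgebra :: "'k::comm_ring_1 mfps set \<Rightarrow> bool" where
  "subcoalgebra D \<longleftrightarrow> mfps.subspace D \<and> D \<subseteq> QSym \<and>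
     (\<forall>f\<in>D. coproduct f \<in> tensor_incl QSym ` tensor_square D)"

definition hopf_subalgebra :: "'k::comm_ring_1 mfps set \<Rightarrow> bool" where
  "hopf_subalgebra D \<longleftrightarrow> subcoalgebra D \<and>
     1 \<in> D \<and> (\<forall>f\<in>D. \<forall>g\<in>D. f * g \<in> D) \<and>
     (\<forall>f\<in>D. antipode f \<in> D)"

definition eta :: "'k::comm_ring_1 \<Rightarrow> nat list \<Rightarrow> 'k mfps" where
  "eta q \<alpha> = (\<Sum>\<beta> | \<beta> \<in> Comp_of (sum_list \<alpha>) \<and> partial_sums \<beta> \<subseteq> partial_sums \<alpha>.
                 mfps_scale ((q + 1) ^ length \<beta>) (M \<beta>))"

definition QSym_sub :: "'k::comm_ring_1 \<Rightarrow> nat list set \<Rightarrow> 'k mfps set" where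
  "QSym_sub q T = mfps.span (eta q ` T)"

end

theory Submission
  imports Defs
begin

text \<open>
  Write \<open>\<eta>\<^sub>\<alpha>\<close> for \<open>\<eta>\<^sub>\<alpha>\<^sup>(\<^sup>1\<^sup>)\<close>.  The span of the \<open>\<eta>\<^sub>\<alpha>\<close> with \<open>\<alpha>\<close> a word over \<open>Y\<close> is a Hopf subalgebra because all
  structure maps of QSym act on the \<open>\<eta>\<^sub>\<alpha>\<close> by operations on words that do not leave the words over \<open>Y\<close>.
  
  The coproduct is deconcatenation, \<open>\<Delta> \<eta>\<^sub>\<alpha> = \<Sum>\<^bsub>\<beta>\<gamma>=\<alpha>\<^esub> \<eta>\<^sub>\<beta> \<otimes> \<eta>\<^sub>\<gamma>\<close> (\<open>coproduct_eta\<close>), since coarsening a word and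
  then cutting it amounts to cutting it and then coarsening the two pieces.  The antipode is reversal
  up to sign, \<open>S \<eta>\<^sub>\<alpha> = (-1)\<^bsup>\<ell>(\<alpha>)\<^esup> \<eta>\<^bsub>rev \<alpha>\<^esub>\<close> (\<open>antipode_eta\<close>), by the binomial theorem for the intervals of
  the coarsening order.
  
  The product is where the ternary sums come from (\<open>eta_mult\<close>).  The part of \<open>\<eta>\<^sub>\<alpha>\<close> in a single variable
  \<open>x\<close> is \<open>1\<close> for the empty word and \<open>2x\<^bsup>|\<alpha>|\<^esup>\<close> otherwise.  With noncommuting letters \<open>\<xi>\<^sub>1, \<xi>\<^sub>2, \<dots>\<close> and
  \<open>Z = \<Sum>\<^sub>a \<xi>\<^sub>a x\<^sup>a\<close>, the generating function of these values is \<open>H = 1 + 2(Z + Z\<^sup>2 + \<dots>) = (1 + Z)/(1 - Z)\<close>, so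
  \<open>Z = (H - 1)/(H + 1)\<close> is the hyperbolic tangent of half the logarithm of \<open>H\<close>.  The product rule dual
  to \<open>H\<close> being group-like is therefore the addition theorem of the hyperbolic tangent,
  \<open>Z = (Z\<^sub>1 + Z\<^sub>2)/(1 + Z\<^sub>1Z\<^sub>2) = (Z\<^sub>1 + Z\<^sub>2)(1 - Z\<^sub>1Z\<^sub>2 + Z\<^sub>1\<^sup>2Z\<^sub>2\<^sup>2 - \<dots>)\<close>.
  Every term has odd degree: \<open>\<eta>\<^sub>\<alpha> \<eta>\<^sub>\<beta>\<close> is a signed sum of \<open>\<eta>\<^sub>w\<close> in which each letter of \<open>w\<close> is a sum of an
  odd number of letters of \<open>\<alpha>\<close> and \<open>\<beta>\<close>, and closure under ternary sums gives closure under all odd sums.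
  The rule passes from one variable to finitely many by splitting off one variable at a time, and to
  power series because these are determined by their truncations.
\<close>
section \<open>Sums over coarsenings\<close>

text \<open>
  This recursion enumerates the \<open>\<beta>\<close> with \<open>D(\<beta>) \<subseteq> D(\<alpha>)\<close> by deciding whether the first two entries of \<open>\<alpha>\<close>
  are merged.  It replaces the sum over subsets of \<open>D(\<alpha>)\<close> by inductions on words; \<open>sum_coarsenings\<close> shows
  the agreement.
\<close>
fun coarsening_sum :: "(nat list \<Rightarrow> 'a::ab_group_add) \<Rightarrow> nat list \<Rightarrow> 'a" where
  "coarsening_sum h [] = h []"
| "coarsening_sum h [a] = h [a]"
| "coarsening_sum h (a # b # \<alpha>) =
     coarsening_sum (\<lambda>\<beta>. h (a # \<beta>)) (b # \<alpha>) + coarsening_sum h ((a + b) # \<alpha>)"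

lemma Comp_Nil [simp]: "[] \<in> Comp"
  by (simp add: Comp_def)

lemma Comp_Cons [simp]: "a # \<alpha> \<in> Comp \<longleftrightarrow> 0 < a \<and> \<alpha> \<in> Comp"
  by (auto simp: Comp_def)

lemma Comp_append [simp]: "\<beta> @ \<gamma> \<in> Comp \<longleftrightarrow> \<beta> \<in> Comp \<and> \<gamma> \<in> Comp"
  by (auto simp: Comp_def)

lemma partial_sums_Nil [simp]: "partial_sums [] = {}"
  by (simp add: partial_sums_def)

lemma partial_sums_Cons:
  "partial_sums (a # \<alpha>) = (\<lambda>i. a + sum_list (take i \<alpha>)) ` {..<length \<alpha>}"
proof (intro equalityI subsetI)
  fix s assume "s \<in> partial_sums (a # \<alpha>)"
  then obtain i where "s = sum_list (take i (a # \<alpha>))" "1 \<le> i" "i < length (a # \<alpha>)"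
    by (auto simp: partial_sums_def)
  then show "s \<in> (\<lambda>i. a + sum_list (take i \<alpha>)) ` {..<length \<alpha>}"
    by (cases i) auto
next
  fix s assume "s \<in> (\<lambda>i. a + sum_list (take i \<alpha>)) ` {..<length \<alpha>}"
  then obtain i where "s = a + sum_list (take i \<alpha>)" "i < length \<alpha>" by auto
  then have "s = sum_list (take (Suc i) (a # \<alpha>)) \<and> 1 \<le> Suc i \<and> Suc i < length (a # \<alpha>)" by simp
  then show "s \<in> partial_sums (a # \<alpha>)"
    unfolding partial_sums_def by blast
qed

lemma partial_sums_Cons_Cons:
  "partial_sums (a # b # \<alpha>) = insert a ((+) a ` partial_sums (b # \<alpha>))"
  by (auto simp: partial_sums_Cons image_image lessThan_Suc_eq_insert_0 add.assoc)

lemma partial_sums_merge: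
  "partial_sums (a # b # \<alpha>) = insert a (partial_sums ((a + b) # \<alpha>))"
  unfolding partial_sums_Cons by (auto simp: image_image lessThan_Suc_eq_insert_0 add.assoc)

lemma partial_sums_ge: "s \<in> partial_sums (a # \<alpha>) \<Longrightarrow> a \<le> s"
  by (auto simp: partial_sums_Cons)

definition coarsenings :: "nat list \<Rightarrow> nat list set" where
  "coarsenings \<alpha> = {\<beta> \<in> Comp_of (sum_list \<alpha>). partial_sums \<beta> \<subseteq> partial_sums \<alpha>}"

lemma finite_coarsenings [simp]: "finite (coarsenings \<alpha>)"
  by (simp add: coarsenings_def)

lemma coarsenings_Nil: "coarsenings [] = {[]}"
proof -
  have "\<beta> = []" if "\<beta> \<in> coarsenings []" for \<beta>
    using that by (cases \<beta>) (auto simp: coarsenings_def Comp_of_def)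
  then show ?thesis by (auto simp: coarsenings_def Comp_of_def)
qed

lemma coarsenings_singleton:
  assumes "0 < a"
  shows "coarsenings [a] = {[a]}"
proof -
  have "\<beta> = [a]" if "\<beta> \<in> coarsenings [a]" for \<beta>
    using that assms
    by (cases \<beta>) (auto simp: coarsenings_def Comp_of_def partial_sums_Cons lessThan_empty_iff)
  then show ?thesis
    using assms by (auto simp: coarsenings_def Comp_of_def)
qed

text \<open>
  The two parts are separated by whether \<open>a\<close>, the least element of \<open>D(a # b # \<alpha>)\<close>, is a partial sum.
\<close>
lemma coarsenings_Cons_Cons:
  assumes "a # b # \<alpha> \<in> Comp"
  shows "coarsenings (a # b # \<alpha>) = (#) a ` coarsenings (b # \<alpha>) \<union> coarsenings ((a + b) # \<alpha>)"
    and "(#) a ` coarsenings (b # \<alpha>) \<inter> coarsenings ((a + b) # \<alpha>) = {}"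
proof -
  have pos: "0 < a" "0 < b" using assms by auto
  have notin: "a \<notin> partial_sums ((a + b) # \<alpha>)"
    using partial_sums_ge[of a "a + b" \<alpha>] pos by auto
  have head: "a \<in> partial_sums (a # \<beta>)" and tail: "partial_sums (a # \<beta>) = insert a ((+) a ` partial_sums \<beta>)"
    if "\<beta> \<in> coarsenings (b # \<alpha>)" for \<beta>
  proof -
    have "\<beta> \<noteq> []" using that pos by (auto simp: coarsenings_def Comp_of_def)
    then obtain c \<gamma> where "\<beta> = c # \<gamma>" by (cases \<beta>) auto
    then show "a \<in> partial_sums (a # \<beta>)" "partial_sums (a # \<beta>) = insert a ((+) a ` partial_sums \<beta>)"
      by (auto simp: partial_sums_Cons_Cons)
  qed
  show "(#) a ` coarsenings (b # \<alpha>) \<inter> coarsenings ((a + b) # \<alpha>) = {}"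
    using head notin by (auto simp: coarsenings_def[of "(a + b) # \<alpha>"])
  show "coarsenings (a # b # \<alpha>) = (#) a ` coarsenings (b # \<alpha>) \<union> coarsenings ((a + b) # \<alpha>)"
  proof (intro equalityI subsetI)
    fix \<beta> assume \<beta>: "\<beta> \<in> coarsenings (a # b # \<alpha>)"
    then have sub: "partial_sums \<beta> \<subseteq> partial_sums (a # b # \<alpha>)"
      by (simp add: coarsenings_def)
    show "\<beta> \<in> (#) a ` coarsenings (b # \<alpha>) \<union> coarsenings ((a + b) # \<alpha>)"
    proof (cases "a \<in> partial_sums \<beta>")
      case False
      then show ?thesis
        using \<beta> sub by (auto simp: coarsenings_def partial_sums_merge add.assoc)
    next
      case True
      then obtain c d \<gamma> where \<beta>_eq: "\<beta> = c # d # \<gamma>"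
        by (cases \<beta>; cases "tl \<beta>") (auto simp: partial_sums_Cons)
      have "c \<in> partial_sums \<beta>" by (simp add: \<beta>_eq partial_sums_Cons_Cons)
      \<comment> \<open>the first entry of \<open>\<beta>\<close> is the least element of its set of partial sums\<close>
      then have "c = a"
        using True sub partial_sums_ge[of a c "d # \<gamma>"] partial_sums_ge[of c a "b # \<alpha>"] \<beta>_eq by auto
      have "partial_sums (d # \<gamma>) \<subseteq> partial_sums (b # \<alpha>)"
      proof
        fix s assume s: "s \<in> partial_sums (d # \<gamma>)"
        then have "a + s \<in> partial_sums (a # b # \<alpha>)"
          using sub \<beta>_eq \<open>c = a\<close> by (auto simp: partial_sums_Cons_Cons)
        moreover have "0 < s"
          using partial_sums_ge[OF s] \<beta> \<beta>_eq by (auto simp: coarsenings_def Comp_of_def)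
        ultimately show "s \<in> partial_sums (b # \<alpha>)"
          by (auto simp: partial_sums_Cons_Cons)
      qed
      then have "d # \<gamma> \<in> coarsenings (b # \<alpha>)"
        using \<beta> \<beta>_eq \<open>c = a\<close> by (auto simp: coarsenings_def Comp_of_def)
      then show ?thesis using \<beta>_eq \<open>c = a\<close> by blast
    qed
  next
    fix \<beta> assume "\<beta> \<in> (#) a ` coarsenings (b # \<alpha>) \<union> coarsenings ((a + b) # \<alpha>)"
    then show "\<beta> \<in> coarsenings (a # b # \<alpha>)"
    proof
      assume "\<beta> \<in> (#) a ` coarsenings (b # \<alpha>)"
      then obtain \<gamma> where \<gamma>: "\<gamma> \<in> coarsenings (b # \<alpha>)" "\<beta> = a # \<gamma>" by blast
      then show ?thesis
        using tail[OF \<gamma>(1)] pos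
        by (auto simp: coarsenings_def Comp_of_def partial_sums_Cons_Cons)
    next
      assume "\<beta> \<in> coarsenings ((a + b) # \<alpha>)"
      then show ?thesis by (auto simp: coarsenings_def partial_sums_merge add.assoc)
    qed
  qed
qed

lemma sum_coarsenings:
  "\<alpha> \<in> Comp \<Longrightarrow> sum h (coarsenings \<alpha>) = coarsening_sum h \<alpha>"
proof (induction h \<alpha> rule: coarsening_sum.induct)
  case (3 h a b \<alpha>)
  have "sum h ((#) a ` coarsenings (b # \<alpha>)) = (\<Sum>\<beta>\<in>coarsenings (b # \<alpha>). h (a # \<beta>))"
    by (subst sum.reindex) auto
  with 3 coarsenings_Cons_Cons[OF 3(3)] show ?case
    by (simp add: sum.union_disjoint)
qed (auto simp: coarsenings_Nil coarsenings_singleton)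

lemma coarsening_sum_cong:
  assumes "\<alpha> \<in> Comp" and "\<And>\<beta>. \<beta> \<in> Comp \<Longrightarrow> h \<beta> = g \<beta>"
  shows "coarsening_sum h \<alpha> = coarsening_sum g \<alpha>"
  unfolding sum_coarsenings[OF assms(1), symmetric]
  by (rule sum.cong) (use assms(2) in \<open>auto simp: coarsenings_def Comp_of_def\<close>)

text \<open>
  Only nonempty words contribute to the sum over the coarsenings of a nonempty word.
\<close>
lemma coarsening_sum_Cons_cong:
  "(\<And>c \<beta>. h (c # \<beta>) = g (c # \<beta>)) \<Longrightarrow> coarsening_sum h (a # \<alpha>) = coarsening_sum g (a # \<alpha>)"
proof (induction \<alpha> arbitrary: h g a)
  case Nil
  then show ?case by simp
next
  case (Cons b \<alpha>)
  have "coarsening_sum (\<lambda>\<beta>. h (a # \<beta>)) (b # \<alpha>) = coarsening_sum (\<lambda>\<beta>. g (a # \<beta>)) (b # \<alpha>)"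
    by (rule Cons.IH) (rule Cons.prems)
  moreover have "coarsening_sum h ((a + b) # \<alpha>) = coarsening_sum g ((a + b) # \<alpha>)"
    by (rule Cons.IH) (rule Cons.prems)
  ultimately show ?case by (simp only: coarsening_sum.simps)
qed

fun add_head :: "nat \<Rightarrow> nat list \<Rightarrow> nat list" where
  "add_head a [] = []"
| "add_head a (b # \<beta>) = (a + b) # \<beta>"

lemma coarsening_sum_add_head:
  "coarsening_sum (\<lambda>\<beta>. f (add_head a \<beta>)) (b # \<alpha>) = coarsening_sum f ((a + b) # \<alpha>)"
proof (induction \<alpha> arbitrary: f b)
  case (Cons c \<alpha>)
  show ?case
    using Cons[of f "b + c"] by (simp add: add.assoc)
qed simp

lemma coarsening_sum_closed:
  assumes V: "\<And>x y. x \<in> V \<Longrightarrow> y \<in> V \<Longrightarrow> x + y \<in> V"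
  shows "\<alpha> \<in> Comp \<Longrightarrow> (\<And>\<beta>. \<beta> \<in> Comp \<Longrightarrow> h \<beta> \<in> V) \<Longrightarrow> coarsening_sum h \<alpha> \<in> V"
  by (induction h \<alpha> rule: coarsening_sum.induct) (auto intro!: V)

text \<open>
  The formation of tensors is additive only on QSym, and there only modulo the bilinearity relations.
  The statement therefore allows a domain \<open>V\<close> of additivity and errors in \<open>N\<close>.
\<close>
lemma coarsening_sum_hom_mod:
  assumes V: "\<And>x y. x \<in> V \<Longrightarrow> y \<in> V \<Longrightarrow> x + y \<in> V"
    and N: "0 \<in> N" "\<And>x y. x \<in> N \<Longrightarrow> y \<in> N \<Longrightarrow> x + y \<in> N"
    and L: "\<And>x y. x \<in> V \<Longrightarrow> y \<in> V \<Longrightarrow> L (x + y) - (L x + L y) \<in> N"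
  shows "\<alpha> \<in> Comp \<Longrightarrow> (\<And>\<beta>. \<beta> \<in> Comp \<Longrightarrow> h \<beta> \<in> V) \<Longrightarrow>
    L (coarsening_sum h \<alpha>) - coarsening_sum (\<lambda>\<beta>. L (h \<beta>)) \<alpha> \<in> N"
proof (induction h \<alpha> rule: coarsening_sum.induct)
  case (3 h a b \<alpha>)
  let ?x = "coarsening_sum (\<lambda>\<beta>. h (a # \<beta>)) (b # \<alpha>)"
    and ?y = "coarsening_sum h ((a + b) # \<alpha>)"
  let ?x' = "coarsening_sum (\<lambda>\<beta>. L (h (a # \<beta>))) (b # \<alpha>)"
    and ?y' = "coarsening_sum (\<lambda>\<beta>. L (h \<beta>)) ((a + b) # \<alpha>)"
  have "?x \<in> V" "?y \<in> V"
    by (intro coarsening_sum_closed[OF V]; use 3(3,4) in simp)+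
  then have "L (?x + ?y) - (L ?x + L ?y) \<in> N" by (rule L)
  moreover have "L ?x - ?x' \<in> N" "L ?y - ?y' \<in> N"
    by (rule 3; use 3(3,4) in simp)+
  ultimately have "(L (?x + ?y) - (L ?x + L ?y)) + ((L ?x - ?x') + (L ?y - ?y')) \<in> N"
    by (intro N)
  then show ?case by (simp add: algebra_simps)
qed (auto simp: N)

lemma coarsening_sum_hom:
  assumes "\<And>x y. x \<in> V \<Longrightarrow> y \<in> V \<Longrightarrow> x + y \<in> V"
    and "\<And>x y. x \<in> V \<Longrightarrow> y \<in> V \<Longrightarrow> L (x + y) = L x + L y"
    and "\<alpha> \<in> Comp" "\<And>\<beta>. \<beta> \<in> Comp \<Longrightarrow> h \<beta> \<in> V"
  shows "L (coarsening_sum h \<alpha>) = coarsening_sum (\<lambda>\<beta>. L (h \<beta>)) \<alpha>"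
  using coarsening_sum_hom_mod[where N = "{0}" and V = V and L = L] assms by simp

lemma coarsening_sum_additive:
  assumes "\<And>x y. L (x + y) = L x + L y"
  shows "L (coarsening_sum h \<alpha>) = coarsening_sum (\<lambda>\<beta>. L (h \<beta>)) \<alpha>"
  by (induction h \<alpha> rule: coarsening_sum.induct) (simp_all add: assms)

lemma coarsening_sum_add:
  "coarsening_sum (\<lambda>\<beta>. g \<beta> + h \<beta>) \<alpha> = coarsening_sum g \<alpha> + coarsening_sum h \<alpha>"
proof (induction \<alpha> arbitrary: g h rule: length_induct)
  case (1 \<alpha>)
  then show ?case by (cases \<alpha> rule: remdups_adj.cases) (auto simp: add_ac)
qed

lemma coarsening_sum_diff:
  "coarsening_sum (\<lambda>\<beta>. g \<beta> - h \<beta>) \<alpha> = coarsening_sum g \<alpha> - coarsening_sum h \<alpha>"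
  using coarsening_sum_add[of "\<lambda>\<beta>. g \<beta> - h \<beta>" h \<alpha>] by (simp add: algebra_simps)

text \<open>
  The defining recursion read from the right end of the word, which is what reversal turns it into.
\<close>
lemma coarsening_sum_snoc:
  "coarsening_sum h (\<alpha> @ [b, a]) =
     coarsening_sum (\<lambda>\<beta>. h (\<beta> @ [a])) (\<alpha> @ [b]) + coarsening_sum h (\<alpha> @ [b + a])"
proof (induction \<alpha> arbitrary: h rule: length_induct)
  case (1 \<alpha>)
  show ?case
  proof (cases \<alpha> rule: remdups_adj.cases)
    case (2 c)
    then show ?thesis by (simp add: add_ac)
  next
    case (3 c d \<gamma>)
    note \<alpha> = 3
    have 1: "coarsening_sum (\<lambda>\<beta>. h (c # \<beta>)) ((d # \<gamma>) @ [b, a]) =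
      coarsening_sum (\<lambda>\<beta>. h (c # \<beta> @ [a])) ((d # \<gamma>) @ [b]) +
      coarsening_sum (\<lambda>\<beta>. h (c # \<beta>)) ((d # \<gamma>) @ [b + a])"
      using 1[rule_format, of "d # \<gamma>" "\<lambda>\<beta>. h (c # \<beta>)"] \<alpha> by simp
    have 2: "coarsening_sum h (((c + d) # \<gamma>) @ [b, a]) =
      coarsening_sum (\<lambda>\<beta>. h (\<beta> @ [a])) (((c + d) # \<gamma>) @ [b]) +
      coarsening_sum h (((c + d) # \<gamma>) @ [b + a])"
      using \<open>\<forall>ys. length ys < length \<alpha> \<longrightarrow> _\<close>[rule_format, of "(c + d) # \<gamma>" h] \<alpha> by simp
    show ?thesis using 1 2 \<alpha> by (simp add: add_ac)
  qed simp
qed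

lemma coarsening_sum_rev:
  "coarsening_sum h (rev \<alpha>) = coarsening_sum (\<lambda>\<beta>. h (rev \<beta>)) \<alpha>"
proof (induction \<alpha> arbitrary: h rule: length_induct)
  case (1 \<alpha>)
  show ?case
  proof (cases \<alpha> rule: remdups_adj.cases)
    case (3 a b \<gamma>)
    note \<alpha> = 3
    have "coarsening_sum h (rev \<alpha>) = coarsening_sum (\<lambda>\<beta>. h (\<beta> @ [a])) (rev (b # \<gamma>)) +
        coarsening_sum h (rev ((a + b) # \<gamma>))"
      by (simp add: \<alpha> coarsening_sum_snoc add.commute)
    also have "\<dots> = coarsening_sum (\<lambda>\<beta>. h (rev (a # \<beta>))) (b # \<gamma>) +
        coarsening_sum (\<lambda>\<beta>. h (rev \<beta>)) ((a + b) # \<gamma>)"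
      using 1[rule_format, of "b # \<gamma>" "\<lambda>\<beta>. h (\<beta> @ [a])"]
        1[rule_format, of "(a + b) # \<gamma>" h] by (simp add: \<alpha> del: rev.simps(2)) simp
    finally show ?thesis by (simp add: \<alpha>)
  qed auto
qed

lemma eta_eq_coarsening_sum:
  assumes "\<alpha> \<in> Comp"
  shows "eta (1 :: 'k::comm_ring_1) \<alpha> =
    coarsening_sum (\<lambda>\<beta>. mfps_scale (2 ^ length \<beta>) (M \<beta>)) \<alpha>"
  unfolding sum_coarsenings[OF assms, symmetric] eta_def coarsenings_def one_add_one ..

lemma coarsening_sum_in_QSym:
  assumes "\<alpha> \<in> Comp" and "\<And>\<beta>. \<beta> \<in> Comp \<Longrightarrow> h \<beta> \<in> QSym"
  shows "coarsening_sum h \<alpha> \<in> QSym"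
  by (rule coarsening_sum_closed) (use assms in \<open>auto intro: mfps.subspace_add[OF subspace_QSym]\<close>)

lemma eta_in_QSym:
  assumes "\<alpha> \<in> Comp"
  shows "eta (1 :: 'k::comm_ring_1) \<alpha> \<in> QSym"
  unfolding eta_eq_coarsening_sum[OF assms] using assms
  by (rule coarsening_sum_in_QSym) (auto intro: mfps.subspace_scale[OF subspace_QSym] M_in_QSym)


section \<open>The antipode\<close>

lemma antipode_add: "f \<in> QSym \<Longrightarrow> g \<in> QSym \<Longrightarrow> antipode (f + g) = antipode f + antipode g"
  by (simp only: antipode_def extend_linearly_add[OF mfps.module_axioms])

lemma antipode_scale: "f \<in> QSym \<Longrightarrow> antipode (mfps_scale c f) = mfps_scale c (antipode f)"
  by (simp only: antipode_def extend_linearly_scale[OF mfps.module_axioms])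

text \<open>
  Exchanging the sums, \<open>g \<gamma>\<close> is counted with \<open>\<Sum> (-2)\<^bsup>\<ell>(\<beta>)\<^esup>\<close> over the \<open>\<beta>\<close> between \<open>\<gamma>\<close> and \<open>\<alpha>\<close>.  By the binomial
  theorem this is \<open>(-2)\<^bsup>\<ell>(\<gamma>)\<^esup> (1 - 2)\<^bsup>\<ell>(\<alpha>)-\<ell>(\<gamma>)\<^esup> = (-1)\<^bsup>\<ell>(\<alpha>)\<^esup> 2\<^bsup>\<ell>(\<gamma>)\<^esup>\<close>.  The induction performs the binomial theorem one
  boundary at a time: the first boundary of \<open>\<alpha>\<close> is either present in \<open>\<gamma>\<close>, or absent from \<open>\<gamma>\<close> and free in
  \<open>\<beta>\<close>, the two choices contributing \<open>-2\<close> and \<open>1\<close>.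
\<close>
lemma signed_coarsening_sum:
  fixes g :: "nat list \<Rightarrow> 'k::comm_ring_1 mfps"
  shows "coarsening_sum (\<lambda>\<beta>. mfps_scale ((- 2) ^ length \<beta>) (coarsening_sum g \<beta>)) \<alpha> =
    mfps_scale ((- 1) ^ length \<alpha>) (coarsening_sum (\<lambda>\<gamma>. mfps_scale (2 ^ length \<gamma>) (g \<gamma>)) \<alpha>)"
proof (induction \<alpha> arbitrary: g rule: length_induct)
  case (1 \<alpha>)
  note IH = 1[rule_format]
  show ?case
  proof (cases \<alpha> rule: remdups_adj.cases)
    case (3 a b \<gamma>)
    note \<alpha> = 3
    let ?S = "\<lambda>g \<beta>. mfps_scale ((- 2) ^ length \<beta>) (coarsening_sum g \<beta>)"
    let ?ga = "\<lambda>\<beta>. g (a # \<beta>)"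
    let ?ab = "(a + b) # \<gamma>"
    let ?R = "\<lambda>g. coarsening_sum (\<lambda>\<gamma>. mfps_scale (2 ^ length \<gamma>) (g \<gamma>))"
    \<comment> \<open>a coarsening of \<open>a # \<beta>\<close> keeps the boundary after \<open>a\<close> or merges \<open>a\<close> into the first entry of \<open>\<beta>\<close>\<close>
    have head: "?S g (a # \<beta>) = mfps_scale (- 2) (?S ?ga \<beta>) + mfps_scale (- 2) (?S g (add_head a \<beta>))"
      if "\<beta> \<noteq> []" for \<beta>
      using that by (cases \<beta>) (auto simp: mfps.scale_right_distrib add.commute)
    have scale: "coarsening_sum (\<lambda>\<beta>. mfps_scale c (h \<beta>)) \<delta> = mfps_scale c (coarsening_sum h \<delta>)"
      for c :: 'k and h \<delta>
      by (rule coarsening_sum_additive[symmetric]) (rule mfps.scale_right_distrib)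
    have "coarsening_sum (?S g) \<alpha> =
        coarsening_sum (\<lambda>\<beta>. ?S g (a # \<beta>)) (b # \<gamma>) + coarsening_sum (?S g) ?ab"
      by (simp only: \<alpha> coarsening_sum.simps)
    also have "coarsening_sum (\<lambda>\<beta>. ?S g (a # \<beta>)) (b # \<gamma>) =
        coarsening_sum (\<lambda>\<beta>. mfps_scale (- 2) (?S ?ga \<beta>) + mfps_scale (- 2) (?S g (add_head a \<beta>))) (b # \<gamma>)"
      by (rule coarsening_sum_Cons_cong) (rule head, simp)
    also have "\<dots> = mfps_scale (- 2) (coarsening_sum (?S ?ga) (b # \<gamma>)) +
        mfps_scale (- 2) (coarsening_sum (?S g) ?ab)"
      unfolding coarsening_sum_add scale coarsening_sum_add_head[where f = "?S g"] ..
    also have "coarsening_sum (?S ?ga) (b # \<gamma>) = mfps_scale (- ((- 1) ^ length \<alpha>)) (?R ?ga (b # \<gamma>))"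
      using IH[of "b # \<gamma>" ?ga] \<alpha> by simp
    also have "coarsening_sum (?S g) ?ab = mfps_scale (- ((- 1) ^ length \<alpha>)) (?R g ?ab)"
      using IH[of ?ab g] \<alpha> by simp
    also have "mfps_scale (- 2) (mfps_scale (- ((- 1) ^ length \<alpha>)) (?R ?ga (b # \<gamma>))) +
        mfps_scale (- 2) (mfps_scale (- ((- 1) ^ length \<alpha>)) (?R g ?ab)) +
        mfps_scale (- ((- 1) ^ length \<alpha>)) (?R g ?ab) =
        mfps_scale ((- 1) ^ length \<alpha>) (mfps_scale 2 (?R ?ga (b # \<gamma>)) + ?R g ?ab)"
      by (rule mfps_eqI) (simp only: mcoeff_simps mcoeff_scale, simp add: algebra_simps)
    also have "mfps_scale 2 (?R ?ga (b # \<gamma>)) + ?R g ?ab = ?R g \<alpha>"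
      by (simp add: \<alpha> scale[symmetric])
    finally show ?thesis .
  qed (auto intro!: mfps_eqI)
qed

text \<open>
  The factor \<open>2\<^bsup>\<ell>(\<beta>)\<^esup>\<close> of \<open>M\<^sub>\<beta>\<close> in \<open>\<eta>\<^sub>\<alpha>\<close> and the sign \<open>(-1)\<^bsup>\<ell>(\<beta>)\<^esup>\<close> of its antipode combine to the weight
  \<open>(-2)\<^bsup>\<ell>(\<beta>)\<^esup>\<close> of \<open>signed_coarsening_sum\<close>.
\<close>
lemma antipode_eta:
  assumes "\<alpha> \<in> Comp"
  shows "antipode (eta (1 :: 'k::comm_ring_1) \<alpha>) = mfps_scale ((- 1) ^ length \<alpha>) (eta 1 (rev \<alpha>))"
proof -
  have rev: "rev \<beta> \<in> Comp" if "\<beta> \<in> Comp" for \<beta>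
    using that by (simp add: Comp_def)
  have M_eq: "antipode (M \<beta> :: 'k mfps) =
      mfps_scale ((- 1) ^ length \<beta>) (coarsening_sum (\<lambda>\<gamma>. M (rev \<gamma>)) \<beta>)" if "\<beta> \<in> Comp" for \<beta>
    using antipode_M[OF that, where 'a = 'k] sum_coarsenings[OF rev[OF that], of "M :: nat list \<Rightarrow> 'k mfps"]
    by (simp add: coarsenings_def coarsening_sum_rev)
  have "antipode (eta (1 :: 'k) \<alpha>) =
      coarsening_sum (\<lambda>\<beta>. antipode (mfps_scale (2 ^ length \<beta>) (M \<beta>))) \<alpha>"
    unfolding eta_eq_coarsening_sum[OF assms]
    by (rule coarsening_sum_hom[where V = QSym])
       (auto simp: assms antipode_add M_in_QSym
         intro!: mfps.subspace_add[OF subspace_QSym] mfps.subspace_scale[OF subspace_QSym])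
  also have "\<dots> = coarsening_sum (\<lambda>\<beta>. mfps_scale (2 ^ length \<beta>) (antipode (M \<beta>))) \<alpha>"
    by (rule coarsening_sum_cong[OF assms])
       (simp add: antipode_scale M_in_QSym)
  also have "\<dots> = coarsening_sum (\<lambda>\<beta>. mfps_scale ((- 2) ^ length \<beta>)
      (coarsening_sum (\<lambda>\<gamma>. M (rev \<gamma>)) \<beta>)) \<alpha>"
    by (rule coarsening_sum_cong[OF assms]) (simp add: M_eq power_mult_distrib[symmetric])
  also have "\<dots> = mfps_scale ((- 1) ^ length \<alpha>) (eta 1 (rev \<alpha>))"
    by (simp add: signed_coarsening_sum eta_eq_coarsening_sum[OF rev[OF assms]] coarsening_sum_rev)
  finally show ?thesis .
qed


section \<open>The coproduct\<close>

definition deconcatenation_sum :: "(nat list \<Rightarrow> nat list \<Rightarrow> 'a::ab_group_add) \<Rightarrow> nat list \<Rightarrow> 'a" where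
  "deconcatenation_sum f \<alpha> = (\<Sum>(\<beta>, \<gamma>) | \<beta> @ \<gamma> = \<alpha>. f \<beta> \<gamma>)"

lemma deconcatenation_sum_Nil [simp]: "deconcatenation_sum f [] = f [] []"
proof -
  have "{(\<beta>, \<gamma>). \<beta> @ \<gamma> = ([] :: nat list)} = {([], [])}" by auto
  then show ?thesis by (simp add: deconcatenation_sum_def)
qed

lemma deconcatenation_sum_Cons [simp]:
  "deconcatenation_sum f (a # \<alpha>) = f [] (a # \<alpha>) + deconcatenation_sum (\<lambda>\<beta>. f (a # \<beta>)) \<alpha>"
proof -
  let ?h = "\<lambda>(\<beta>, \<gamma>). (a # \<beta>, \<gamma>)" and ?A = "{(\<beta>, \<gamma>). \<beta> @ \<gamma> = \<alpha>}"
  have "{(\<beta>, \<gamma>). \<beta> @ \<gamma> = a # \<alpha>} = insert ([], a # \<alpha>) (?h ` ?A)"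
    by (auto simp: Cons_eq_append_conv append_eq_Cons_conv image_iff)
  moreover have "([], a # \<alpha>) \<notin> ?h ` ?A" by auto
  moreover have "(\<Sum>(\<beta>, \<gamma>)\<in>?h ` ?A. f \<beta> \<gamma>) = (\<Sum>(\<beta>, \<gamma>)\<in>?A. f (a # \<beta>) \<gamma>)"
    by (subst sum.reindex) (auto simp: inj_on_def intro!: sum.cong)
  ultimately show ?thesis by (simp add: deconcatenation_sum_def)
qed

lemma deconcatenation_sum_add:
  "deconcatenation_sum (\<lambda>\<beta> \<gamma>. f \<beta> \<gamma> + g \<beta> \<gamma>) \<alpha> = deconcatenation_sum f \<alpha> + deconcatenation_sum g \<alpha>"
  by (induction \<alpha> arbitrary: f g) (simp_all add: add_ac)

text \<open>
  A coarsening of \<open>\<alpha>\<close> cut at one of its boundaries is a cut of \<open>\<alpha>\<close> with both pieces coarsened, as every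
  boundary of a coarsening is one of \<open>\<alpha>\<close>.
\<close>
lemma coarsening_sum_deconcatenation:
  "coarsening_sum (deconcatenation_sum f) \<alpha> =
     deconcatenation_sum (\<lambda>\<beta> \<gamma>. coarsening_sum (\<lambda>\<beta>'. coarsening_sum (f \<beta>') \<gamma>) \<beta>) \<alpha>"
proof (induction \<alpha> arbitrary: f rule: length_induct)
  case (1 \<alpha>)
  note IH = 1[rule_format]
  show ?case
  proof (cases \<alpha> rule: remdups_adj.cases)
    case (3 a b \<gamma>)
    note \<alpha> = 3
    let ?K = "\<lambda>f \<beta> \<gamma>. coarsening_sum (\<lambda>\<beta>'. coarsening_sum (f \<beta>') \<gamma>) \<beta>"
    let ?fa = "\<lambda>\<beta>. f (a # \<beta>)"
    have "coarsening_sum (deconcatenation_sum f) \<alpha> = coarsening_sum (\<lambda>\<beta>. f [] (a # \<beta>)) (b # \<gamma>) +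
        coarsening_sum (deconcatenation_sum ?fa) (b # \<gamma>) +
        coarsening_sum (deconcatenation_sum f) ((a + b) # \<gamma>)"
      by (simp only: \<alpha> coarsening_sum.simps deconcatenation_sum_Cons coarsening_sum_add)
    also have "coarsening_sum (deconcatenation_sum ?fa) (b # \<gamma>) =
        coarsening_sum (f [a]) (b # \<gamma>) + deconcatenation_sum (\<lambda>\<beta>. ?K ?fa (b # \<beta>)) \<gamma>"
      using IH[of "b # \<gamma>" ?fa] \<alpha> by simp
    also have "coarsening_sum (deconcatenation_sum f) ((a + b) # \<gamma>) =
        coarsening_sum (f []) ((a + b) # \<gamma>) + deconcatenation_sum (\<lambda>\<beta>. ?K f ((a + b) # \<beta>)) \<gamma>"
      using IH[of "(a + b) # \<gamma>" f] \<alpha> by simp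
    also have "coarsening_sum (\<lambda>\<beta>. f [] (a # \<beta>)) (b # \<gamma>) +
        (coarsening_sum (f [a]) (b # \<gamma>) + deconcatenation_sum (\<lambda>\<beta>. ?K ?fa (b # \<beta>)) \<gamma>) +
        (coarsening_sum (f []) ((a + b) # \<gamma>) + deconcatenation_sum (\<lambda>\<beta>. ?K f ((a + b) # \<beta>)) \<gamma>) =
        deconcatenation_sum (?K f) \<alpha>"
      by (simp add: \<alpha> deconcatenation_sum_add algebra_simps)
    finally show ?thesis .
  qed simp_all
qed

lemma deconcatenation_sum_in_subspace:
  assumes "free.subspace N" and "\<And>\<beta> \<gamma>. \<beta> @ \<gamma> = \<alpha> \<Longrightarrow> f \<beta> \<gamma> \<in> N"
  shows "deconcatenation_sum f \<alpha> \<in> N"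
  unfolding deconcatenation_sum_def
  by (rule free.subspace_sum[OF assms(1)]) (use assms(2) in auto)

lemma coproduct_rep_add:
  "f \<in> QSym \<Longrightarrow> g \<in> QSym \<Longrightarrow> coproduct_rep (f + g) = coproduct_rep f + coproduct_rep g"
  by (simp only: coproduct_rep_def extend_linearly_add[OF free.module_axioms])

lemma coproduct_rep_scale:
  "f \<in> QSym \<Longrightarrow> coproduct_rep (mfps_scale c f) = free_scale c (coproduct_rep f)"
  by (simp only: coproduct_rep_def extend_linearly_scale[OF free.module_axioms])

lemma coproduct_rep_eta_eq:
  assumes "\<alpha> \<in> Comp"
  shows "coproduct_rep (eta (1 :: 'k::comm_ring_1) \<alpha>) = coarsening_sum (deconcatenation_sum
    (\<lambda>\<beta> \<gamma>. free_scale (2 ^ length \<beta> * 2 ^ length \<gamma>) (pair_gen (M \<beta>) (M \<gamma>)))) \<alpha>"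
proof -
  have "coproduct_rep (eta (1 :: 'k) \<alpha>) =
      coarsening_sum (\<lambda>\<beta>. coproduct_rep (mfps_scale (2 ^ length \<beta>) (M \<beta>))) \<alpha>"
    unfolding eta_eq_coarsening_sum[OF assms]
    by (rule coarsening_sum_hom[where V = QSym])
       (auto simp: assms coproduct_rep_add M_in_QSym
         intro!: mfps.subspace_add[OF subspace_QSym] mfps.subspace_scale[OF subspace_QSym])
  also have "\<dots> = coarsening_sum (deconcatenation_sum
      (\<lambda>\<beta> \<gamma>. free_scale (2 ^ length \<beta> * 2 ^ length \<gamma>) (pair_gen (M \<beta>) (M \<gamma>)))) \<alpha>"
  proof (rule coarsening_sum_cong[OF assms])
    fix \<beta> assume \<beta>: "\<beta> \<in> Comp"
    have "coproduct_rep (mfps_scale (2 ^ length \<beta>) (M \<beta>) :: 'k mfps) =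
        free_scale (2 ^ length \<beta>) (\<Sum>(\<delta>, \<gamma>) | \<delta> @ \<gamma> = \<beta>. pair_gen (M \<delta>) (M \<gamma>))"
      using \<beta> by (simp add: coproduct_rep_scale M_in_QSym)
         (simp add: coproduct_rep_def extend_linearly_M[OF free.module_axioms])
    also have "\<dots> = deconcatenation_sum
        (\<lambda>\<beta> \<gamma>. free_scale (2 ^ length \<beta> * 2 ^ length \<gamma>) (pair_gen (M \<beta>) (M \<gamma>))) \<beta>"
      unfolding deconcatenation_sum_def free.scale_sum_right
      by (rule sum.cong) (auto simp: power_add)
    finally show "coproduct_rep (mfps_scale (2 ^ length \<beta>) (M \<beta>) :: 'k mfps) = \<dots>" .
  qed
  finally show ?thesis .
qed

abbreviation tensor_relations :: "'k::comm_ring_1 free_pairs set" where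
  "tensor_relations \<equiv> free.span (bilinear_rels QSym)"

lemma pair_gen_add_left:
  assumes "f \<in> QSym" "g \<in> QSym" "h \<in> QSym"
  shows "pair_gen (f + g) h - (pair_gen f h + pair_gen g h) \<in> tensor_relations"
proof -
  have "pair_gen (f + g) h - pair_gen f h - pair_gen g h \<in> bilinear_rels QSym"
    using assms unfolding bilinear_rels_def by blast
  then show ?thesis by (simp add: diff_diff_eq free.span_base)
qed

lemma pair_gen_add_right:
  assumes "f \<in> QSym" "g \<in> QSym" "h \<in> QSym"
  shows "pair_gen f (g + h) - (pair_gen f g + pair_gen f h) \<in> tensor_relations"
proof -
  have "pair_gen f (g + h) - pair_gen f g - pair_gen f h \<in> bilinear_rels QSym"
    using assms unfolding bilinear_rels_def by blast
  then show ?thesis by (simp add: diff_diff_eq free.span_base)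
qed

lemma pair_gen_scale:
  assumes "f \<in> QSym" "g \<in> QSym"
  shows "pair_gen (mfps_scale c f) (mfps_scale d g) - free_scale (c * d) (pair_gen f g)
    \<in> tensor_relations"
proof -
  have "mfps_scale d g \<in> QSym" using assms by (intro mfps.subspace_scale[OF subspace_QSym])
  then have "pair_gen (mfps_scale c f) (mfps_scale d g) - free_scale c (pair_gen f (mfps_scale d g))
      \<in> bilinear_rels QSym"
    using assms unfolding bilinear_rels_def by blast
  moreover have "pair_gen f (mfps_scale d g) - free_scale d (pair_gen f g) \<in> bilinear_rels QSym"
    using assms unfolding bilinear_rels_def by blast
  ultimately have "(pair_gen (mfps_scale c f) (mfps_scale d g) -
        free_scale c (pair_gen f (mfps_scale d g))) +
      free_scale c (pair_gen f (mfps_scale d g) - free_scale d (pair_gen f g)) \<in> tensor_relations"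
    by (intro free.span_add free.span_scale free.span_base)
  then show ?thesis by (simp add: free.scale_right_diff_distrib)
qed

text \<open>
  Bilinear expansion of a tensor of two coarsening sums.  The terms \<open>u \<beta>' \<gamma>'\<close> may be any representatives of the
  tensors \<open>g \<beta>' \<otimes> h \<gamma>'\<close>, so that scalars can be collected in the same step.
\<close>
lemma pair_gen_coarsening_sum:
  fixes g h :: "nat list \<Rightarrow> 'k::comm_ring_1 mfps"
  assumes "\<beta> \<in> Comp" "\<gamma> \<in> Comp"
    and g: "\<And>\<delta>. \<delta> \<in> Comp \<Longrightarrow> g \<delta> \<in> QSym" and h: "\<And>\<delta>. \<delta> \<in> Comp \<Longrightarrow> h \<delta> \<in> QSym"
    and u: "\<And>\<beta>' \<gamma>'. \<beta>' \<in> Comp \<Longrightarrow> \<gamma>' \<in> Comp \<Longrightarrow> pair_gen (g \<beta>') (h \<gamma>') - u \<beta>' \<gamma>' \<in> tensor_relations"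
  shows "pair_gen (coarsening_sum g \<beta>) (coarsening_sum h \<gamma>) -
    coarsening_sum (\<lambda>\<beta>'. coarsening_sum (u \<beta>') \<gamma>) \<beta> \<in> tensor_relations"
proof -
  note add = free.span_add mfps.subspace_add[OF subspace_QSym] free.span_zero
  let ?y = "coarsening_sum h \<gamma>"
  have y: "?y \<in> QSym" by (rule coarsening_sum_in_QSym) (use assms in auto)
  have "pair_gen (coarsening_sum g \<beta>) ?y - coarsening_sum (\<lambda>\<beta>'. pair_gen (g \<beta>') ?y) \<beta> \<in> tensor_relations"
    by (rule coarsening_sum_hom_mod[where V = QSym and L = "\<lambda>f. pair_gen f ?y"])
       (use assms y in \<open>auto intro!: add pair_gen_add_left\<close>)
  moreover have "coarsening_sum (\<lambda>\<beta>'. pair_gen (g \<beta>') ?y - coarsening_sum (u \<beta>') \<gamma>) \<beta> \<in> tensor_relations"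
  proof (rule coarsening_sum_closed[OF free.span_add assms(1)])
    fix \<beta>' assume \<beta>': "\<beta>' \<in> Comp"
    have "pair_gen (g \<beta>') ?y - coarsening_sum (\<lambda>\<gamma>'. pair_gen (g \<beta>') (h \<gamma>')) \<gamma> \<in> tensor_relations"
      by (rule coarsening_sum_hom_mod[where V = QSym and L = "pair_gen (g \<beta>')"])
         (use assms \<beta>' in \<open>auto intro!: add pair_gen_add_right\<close>)
    moreover have "coarsening_sum (\<lambda>\<gamma>'. pair_gen (g \<beta>') (h \<gamma>') - u \<beta>' \<gamma>') \<gamma> \<in> tensor_relations"
      by (rule coarsening_sum_closed[OF free.span_add]) (use assms(2) u \<beta>' in auto)
    ultimately have "(pair_gen (g \<beta>') ?y - coarsening_sum (\<lambda>\<gamma>'. pair_gen (g \<beta>') (h \<gamma>')) \<gamma>) +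
        coarsening_sum (\<lambda>\<gamma>'. pair_gen (g \<beta>') (h \<gamma>') - u \<beta>' \<gamma>') \<gamma> \<in> tensor_relations"
      by (rule free.span_add)
    then show "pair_gen (g \<beta>') ?y - coarsening_sum (u \<beta>') \<gamma> \<in> tensor_relations"
      by (simp add: coarsening_sum_diff)
  qed
  ultimately have "(pair_gen (coarsening_sum g \<beta>) ?y - coarsening_sum (\<lambda>\<beta>'. pair_gen (g \<beta>') ?y) \<beta>) +
      coarsening_sum (\<lambda>\<beta>'. pair_gen (g \<beta>') ?y - coarsening_sum (u \<beta>') \<gamma>) \<beta> \<in> tensor_relations"
    by (rule free.span_add)
  then show ?thesis by (simp add: coarsening_sum_diff)
qed

text \<open>
  Cutting preserves the total length, so the weight \<open>2\<^bsup>\<ell>(\<beta>)\<^esup>\<close> of \<open>M\<^sub>\<beta>\<close> in \<open>\<eta>\<^sub>\<alpha>\<close> is the product of the weights of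
  the two pieces of \<open>\<beta>\<close>.
\<close>
lemma coproduct_eta:
  assumes "\<alpha> \<in> Comp"
  shows "coproduct_rep (eta (1 :: 'k::comm_ring_1) \<alpha>) -
    deconcatenation_sum (\<lambda>\<beta> \<gamma>. pair_gen (eta 1 \<beta>) (eta 1 \<gamma>)) \<alpha> \<in> tensor_relations"
proof -
  let ?u = "\<lambda>\<beta> \<gamma>. free_scale (2 ^ length \<beta> * 2 ^ length \<gamma>) (pair_gen (M \<beta>) (M \<gamma>)) :: 'k free_pairs"
  let ?K = "\<lambda>\<beta> \<gamma>. coarsening_sum (\<lambda>\<beta>'. coarsening_sum (?u \<beta>') \<gamma>) \<beta>"
  have "pair_gen (eta (1 :: 'k) \<beta>) (eta 1 \<gamma>) - ?K \<beta> \<gamma> \<in> tensor_relations"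
    if "\<beta> @ \<gamma> = \<alpha>" for \<beta> \<gamma>
  proof -
    have "\<beta> \<in> Comp" "\<gamma> \<in> Comp" using that assms by auto
    then show ?thesis
      unfolding eta_eq_coarsening_sum[OF \<open>\<beta> \<in> Comp\<close>] eta_eq_coarsening_sum[OF \<open>\<gamma> \<in> Comp\<close>]
      by (rule pair_gen_coarsening_sum)
         (auto intro!: mfps.subspace_scale[OF subspace_QSym] M_in_QSym pair_gen_scale)
  qed
  then have "deconcatenation_sum (\<lambda>\<beta> \<gamma>. pair_gen (eta (1 :: 'k) \<beta>) (eta 1 \<gamma>) - ?K \<beta> \<gamma>) \<alpha> \<in> tensor_relations"
    by (intro deconcatenation_sum_in_subspace free.subspace_span)
  also have "deconcatenation_sum (\<lambda>\<beta> \<gamma>. pair_gen (eta (1 :: 'k) \<beta>) (eta 1 \<gamma>) - ?K \<beta> \<gamma>) \<alpha> =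
      deconcatenation_sum (\<lambda>\<beta> \<gamma>. pair_gen (eta 1 \<beta>) (eta 1 \<gamma>)) \<alpha> - deconcatenation_sum ?K \<alpha>"
    unfolding deconcatenation_sum_def case_prod_unfold sum_subtractf ..
  also have "deconcatenation_sum ?K \<alpha> = coproduct_rep (eta (1 :: 'k) \<alpha>)"
    unfolding coarsening_sum_deconcatenation[symmetric] coproduct_rep_eta_eq[OF assms] ..
  finally have "- (deconcatenation_sum (\<lambda>\<beta> \<gamma>. pair_gen (eta 1 \<beta>) (eta 1 \<gamma>)) \<alpha> -
      coproduct_rep (eta (1 :: 'k) \<alpha>)) \<in> tensor_relations"
    by (rule free.span_neg)
  then show ?thesis by (simp only: minus_diff_eq)
qed


section \<open>Spans closed under coproduct and antipode\<close>

lemma QSym_sub_minimal: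
  "mfps.subspace P \<Longrightarrow> (\<And>\<alpha>. \<alpha> \<in> T \<Longrightarrow> eta q \<alpha> \<in> P) \<Longrightarrow> QSym_sub q T \<subseteq> P"
  unfolding QSym_sub_def by (rule mfps.span_minimal) auto

lemma QSym_sub_subset_QSym: "T \<subseteq> Comp \<Longrightarrow> QSym_sub (1 :: 'k::comm_ring_1) T \<subseteq> QSym"
  by (rule QSym_sub_minimal[OF subspace_QSym]) (auto intro: eta_in_QSym)

lemma eta_in_QSym_sub: "\<alpha> \<in> T \<Longrightarrow> eta q \<alpha> \<in> QSym_sub q T"
  unfolding QSym_sub_def by (blast intro: mfps.span_base)

lemma subspace_free_on:
  fixes A :: "('k::comm_ring_1 mfps \<times> 'k mfps) set"
  shows "free.subspace {u :: 'k free_pairs. Poly_Mapping.keys u \<subseteq> A}"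
proof (rule free.subspaceI)
  fix u v :: "'k free_pairs"
  assume "u \<in> {u. Poly_Mapping.keys u \<subseteq> A}" "v \<in> {u. Poly_Mapping.keys u \<subseteq> A}"
  then show "u + v \<in> {u. Poly_Mapping.keys u \<subseteq> A}"
    using keys_add[of u v] by blast
next
  fix c and u :: "'k free_pairs"
  assume "u \<in> {u. Poly_Mapping.keys u \<subseteq> A}"
  moreover have "Poly_Mapping.keys (free_scale c u) \<subseteq> Poly_Mapping.keys u"
    by (auto simp: in_keys_iff)
  ultimately show "free_scale c u \<in> {u. Poly_Mapping.keys u \<subseteq> A}"
    by blast
qed simp

text \<open>
  The representative \<open>u\<close> of the coproduct is taken in the free module on \<open>D \<times> D\<close>; the class of \<open>u\<close> in
  \<open>D \<otimes> D\<close> is then a preimage under the canonical map.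
\<close>
lemma subcoalgebra_QSym_sub:
  assumes T: "T \<subseteq> Comp" and deconc: "\<And>\<beta> \<gamma>. \<beta> @ \<gamma> \<in> T \<Longrightarrow> \<beta> \<in> T \<and> \<gamma> \<in> T"
  shows "subcoalgebra (QSym_sub (1 :: 'k::comm_ring_1) T)"
proof -
  let ?D = "QSym_sub (1 :: 'k) T"
  let ?F = "{u :: 'k free_pairs. Poly_Mapping.keys u \<subseteq> ?D \<times> ?D}"
  let ?P = "{f \<in> QSym. \<exists>u\<in>?F. coproduct_rep f - u \<in> tensor_relations}"
  have sub: "mfps.subspace ?P"
  proof (rule mfps.subspaceI)
    have "coproduct_rep (0 :: 'k mfps) - 0 \<in> tensor_relations"
      by (simp add: coproduct_rep_def extend_linearly_def M_coeff_def free.span_zero)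
    moreover have "0 \<in> ?F" by (rule free.subspace_0[OF subspace_free_on])
    ultimately show "0 \<in> ?P"
      using mfps.subspace_0[OF subspace_QSym] by blast
  next
    fix f g assume "f \<in> ?P" "g \<in> ?P"
    then obtain u v where *: "f \<in> QSym" "g \<in> QSym" "u \<in> ?F" "v \<in> ?F"
      "coproduct_rep f - u \<in> tensor_relations" "coproduct_rep g - v \<in> tensor_relations"
      by blast
    have "coproduct_rep (f + g) - (u + v) = (coproduct_rep f - u) + (coproduct_rep g - v)"
      by (simp add: coproduct_rep_add[OF *(1,2)])
    also have "\<dots> \<in> tensor_relations" by (rule free.span_add[OF *(5,6)])
    finally have "coproduct_rep (f + g) - (u + v) \<in> tensor_relations" .
    moreover have "u + v \<in> ?F" using * by (intro free.subspace_add[OF subspace_free_on])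
    moreover have "f + g \<in> QSym" using * by (intro mfps.subspace_add[OF subspace_QSym])
    ultimately show "f + g \<in> ?P" by blast
  next
    fix c f assume "f \<in> ?P"
    then obtain u where *: "f \<in> QSym" "u \<in> ?F" "coproduct_rep f - u \<in> tensor_relations"
      by blast
    have "coproduct_rep (mfps_scale c f) - free_scale c u = free_scale c (coproduct_rep f - u)"
      by (simp add: coproduct_rep_scale[OF *(1)] free.scale_right_diff_distrib)
    also have "\<dots> \<in> tensor_relations" by (rule free.span_scale[OF *(3)])
    finally have "coproduct_rep (mfps_scale c f) - free_scale c u \<in> tensor_relations" .
    moreover have "free_scale c u \<in> ?F" using * by (intro free.subspace_scale[OF subspace_free_on])
    moreover have "mfps_scale c f \<in> QSym" using * by (intro mfps.subspace_scale[OF subspace_QSym])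
    ultimately show "mfps_scale c f \<in> ?P" by blast
  qed
  have "eta 1 \<alpha> \<in> ?P" if "\<alpha> \<in> T" for \<alpha>
  proof -
    have "\<alpha> \<in> Comp" using that T by blast
    moreover have "deconcatenation_sum (\<lambda>\<beta> \<gamma>. pair_gen (eta (1 :: 'k) \<beta>) (eta 1 \<gamma>)) \<alpha> \<in> ?F"
    proof (rule deconcatenation_sum_in_subspace[OF subspace_free_on])
      fix \<beta> \<gamma> assume "\<beta> @ \<gamma> = \<alpha>"
      then have "\<beta> \<in> T" "\<gamma> \<in> T" using deconc[of \<beta> \<gamma>] that by simp_all
      then show "pair_gen (eta (1 :: 'k) \<beta>) (eta 1 \<gamma>) \<in> ?F"
        by (simp add: eta_in_QSym_sub)
    qed
    ultimately show ?thesis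
      using coproduct_eta[of \<alpha>, where 'k = 'k] eta_in_QSym[of \<alpha>, where 'k = 'k] by blast
  qed
  then have "?D \<subseteq> ?P" by (rule QSym_sub_minimal[OF sub])
  have "coproduct f \<in> tensor_incl QSym ` tensor_square ?D" if "f \<in> ?D" for f
  proof -
    have "f \<in> ?P" using \<open>?D \<subseteq> ?P\<close> that by blast
    then obtain u where u: "u \<in> ?F" "coproduct_rep f - u \<in> tensor_relations" by blast
    have "coproduct f = tensor_incl QSym (tensor_class ?D u)"
      unfolding coproduct_def tensor_incl_class[OF QSym_sub_subset_QSym[OF T]]
      using u(2) by (simp only: tensor_class_eq_iff)
    moreover have "tensor_class ?D u \<in> tensor_square ?D"
      using u(1) unfolding tensor_square_def by (rule imageI)
    ultimately show ?thesis by blast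
  qed
  then show ?thesis
    unfolding subcoalgebra_def using QSym_sub_subset_QSym[OF T]
    by (auto simp: QSym_sub_def mfps.subspace_span)
qed

lemma antipode_QSym_sub:
  assumes T: "T \<subseteq> Comp" and rev: "\<And>\<alpha>. \<alpha> \<in> T \<Longrightarrow> rev \<alpha> \<in> T"
    and f: "f \<in> QSym_sub (1 :: 'k::comm_ring_1) T"
  shows "antipode f \<in> QSym_sub 1 T"
proof -
  let ?D = "QSym_sub (1 :: 'k) T"
  let ?P = "{f \<in> QSym. antipode f \<in> ?D}"
  have D: "mfps.subspace ?D" by (simp add: QSym_sub_def mfps.subspace_span)
  have "mfps.subspace ?P"
  proof (rule mfps.subspaceI)
    have "antipode (0 :: 'k mfps) = 0"
      by (simp add: antipode_def extend_linearly_def M_coeff_def)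
    then show "0 \<in> ?P"
      using mfps.subspace_0[OF subspace_QSym] mfps.subspace_0[OF D] by simp
    show "f + g \<in> ?P" if "f \<in> ?P" "g \<in> ?P" for f g
      using that by (auto simp: antipode_add intro: mfps.subspace_add subspace_QSym D)
    show "mfps_scale c f \<in> ?P" if "f \<in> ?P" for c f
      using that by (auto simp: antipode_scale intro: mfps.subspace_scale subspace_QSym D)
  qed
  moreover have "eta 1 \<alpha> \<in> ?P" if "\<alpha> \<in> T" for \<alpha>
  proof -
    have "\<alpha> \<in> Comp" using that T by blast
    then show ?thesis
      using eta_in_QSym_sub[OF rev[OF that]]
      by (auto simp: antipode_eta eta_in_QSym intro: mfps.subspace_scale[OF D])
  qed
  ultimately have "?D \<subseteq> ?P" by (rule QSym_sub_minimal)
  then show ?thesis using f by blast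
qed


section \<open>The product rule on words\<close>

text \<open>
  Here \<open>F w\<close> stands for \<open>\<eta>\<^sub>w\<close>, or for any other family of values attached to words.  For \<open>s = 0\<close> and
  \<open>\<alpha>\<close>, \<open>\<beta>\<close> not both empty, the result is the product expansion of \<open>\<eta>\<^sub>\<alpha> \<eta>\<^sub>\<beta>\<close>; for general \<open>s\<close>, the first letter of each
  resulting word is increased by \<open>s\<close>.  The recursion is dual to the addition theorem in the form
  \<open>Z = Z\<^sub>1 + Z\<^sub>2 - Z\<^sub>1Z\<^sub>2Z\<close>: the first letter of the result is \<open>a\<close>, or \<open>b\<close>, or (with a sign) it consists of
  \<open>a + b\<close> and a further first letter.  Passing \<open>s\<close> along expresses this last term without knowing
  how many letters are merged.
\<close>
fun stuffle_shift :: "(nat list \<Rightarrow> 'a::ab_group_add) \<Rightarrow> nat \<Rightarrow> nat list \<Rightarrow> nat list \<Rightarrow> 'a" where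
  "stuffle_shift F s [] [] = 0"
| "stuffle_shift F s (a # \<alpha>) [] = F ((s + a) # \<alpha>)"
| "stuffle_shift F s [] (b # \<beta>) = F ((s + b) # \<beta>)"
| "stuffle_shift F s (a # \<alpha>) (b # \<beta>) =
     stuffle_shift (\<lambda>w. F ((s + a) # w)) 0 \<alpha> (b # \<beta>) + stuffle_shift (\<lambda>w. F ((s + b) # w)) 0 (a # \<alpha>) \<beta> -
     stuffle_shift F (s + a + b) \<alpha> \<beta>"

text \<open>
  The empty word has no first letter, so the product of two empty words has to be treated separately.
\<close>
definition stuffle :: "(nat list \<Rightarrow> 'a::ab_group_add) \<Rightarrow> nat list \<Rightarrow> nat list \<Rightarrow> 'a" where
  "stuffle F \<alpha> \<beta> = (if \<alpha> = [] \<and> \<beta> = [] then F [] else stuffle_shift F 0 \<alpha> \<beta>)"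

lemma stuffle_shift_additive:
  fixes L :: "'a::ab_group_add \<Rightarrow> 'b::ab_group_add"
  assumes L: "\<And>x y. L (x + y) = L x + L y"
  shows "stuffle_shift (\<lambda>w. L (F w)) s \<alpha> \<beta> = L (stuffle_shift F s \<alpha> \<beta>)"
proof -
  have 0: "L 0 = 0" using L[of 0 0] by simp
  have diff: "L (x - y) = L x - L y" for x y
    using L[of "x - y" y] by simp
  show ?thesis
    by (induction F s \<alpha> \<beta> rule: stuffle_shift.induct) (simp_all add: L 0 diff)
qed

lemma stuffle_shift_add: "stuffle_shift (\<lambda>w. F w + G w) s \<alpha> \<beta> = stuffle_shift F s \<alpha> \<beta> + stuffle_shift G s \<alpha> \<beta>"
proof (induction "length \<alpha> + length \<beta>" arbitrary: F G s \<alpha> \<beta> rule: less_induct)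
  case less
  then show ?case by (cases \<alpha>; cases \<beta>) (simp_all add: algebra_simps)
qed

text \<open>
  The invariant says that \<open>s\<close> behaves like a sum of an even number of elements of \<open>Y\<close>: it starts at \<open>0\<close>
  and grows by two letters at a time.
\<close>
lemma stuffle_shift_closed:
  assumes V: "0 \<in> V" "\<And>x y. x \<in> V \<Longrightarrow> y \<in> V \<Longrightarrow> x + y \<in> V" "\<And>x y. x \<in> V \<Longrightarrow> y \<in> V \<Longrightarrow> x - y \<in> V"
    and Y: "\<And>y z w. y \<in> Y \<Longrightarrow> z \<in> Y \<Longrightarrow> w \<in> Y \<Longrightarrow> y + z + w \<in> Y"
  shows "\<alpha> \<in> lists Y \<Longrightarrow> \<beta> \<in> lists Y \<Longrightarrow> (\<And>w. w \<in> lists Y \<Longrightarrow> F w \<in> V) \<Longrightarrow>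
    (\<And>y. y \<in> Y \<Longrightarrow> s + y \<in> Y) \<Longrightarrow> stuffle_shift F s \<alpha> \<beta> \<in> V"
proof (induction F s \<alpha> \<beta> rule: stuffle_shift.induct)
  case (4 F s a \<alpha> b \<beta>)
  have "s + a + b + y \<in> Y" if "y \<in> Y" for y
    using 4(7)[OF Y[of a b y]] 4(4,5) that by (simp add: add.assoc)
  with 4 show ?case
    unfolding stuffle_shift.simps by (intro V) auto
qed (auto simp: V)

lemma stuffle_closed:
  assumes "0 \<in> V" "\<And>x y. x \<in> V \<Longrightarrow> y \<in> V \<Longrightarrow> x + y \<in> V" "\<And>x y. x \<in> V \<Longrightarrow> y \<in> V \<Longrightarrow> x - y \<in> V"
    and "\<And>y z w. y \<in> Y \<Longrightarrow> z \<in> Y \<Longrightarrow> w \<in> Y \<Longrightarrow> y + z + w \<in> Y"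
    and "\<alpha> \<in> lists Y" "\<beta> \<in> lists Y" "\<And>w. w \<in> lists Y \<Longrightarrow> F w \<in> V"
  shows "stuffle F \<alpha> \<beta> \<in> V"
  unfolding stuffle_def using stuffle_shift_closed[of V Y \<alpha> \<beta> F 0] assms by auto

lemma stuffle_shift_cong:
  "\<alpha> \<in> Comp \<Longrightarrow> \<beta> \<in> Comp \<Longrightarrow> (\<And>w. w \<in> Comp \<Longrightarrow> F w = G w) \<Longrightarrow> stuffle_shift F s \<alpha> \<beta> = stuffle_shift G s \<alpha> \<beta>"
proof (induction "length \<alpha> + length \<beta>" arbitrary: F G s \<alpha> \<beta> rule: less_induct)
  case less
  note IH = less.hyps and F = less.prems(3)
  show ?case
  proof (cases \<alpha>; cases \<beta>)
    fix a \<alpha>' b \<beta>' assume eq: "\<alpha> = a # \<alpha>'" "\<beta> = b # \<beta>'"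
    have "stuffle_shift (\<lambda>w. F ((s + a) # w)) 0 \<alpha>' (b # \<beta>') = stuffle_shift (\<lambda>w. G ((s + a) # w)) 0 \<alpha>' (b # \<beta>')"
      "stuffle_shift (\<lambda>w. F ((s + b) # w)) 0 (a # \<alpha>') \<beta>' = stuffle_shift (\<lambda>w. G ((s + b) # w)) 0 (a # \<alpha>') \<beta>'"
      "stuffle_shift F (s + a + b) \<alpha>' \<beta>' = stuffle_shift G (s + a + b) \<alpha>' \<beta>'"
      by (rule IH; use less.prems eq in \<open>auto intro!: F\<close>)+
    then show ?thesis by (simp only: eq stuffle_shift.simps)
  qed (use less.prems in \<open>auto intro!: F\<close>)
qed

lemma stuffle_cong:
  "\<alpha> \<in> Comp \<Longrightarrow> \<beta> \<in> Comp \<Longrightarrow> (\<And>w. w \<in> Comp \<Longrightarrow> F w = G w) \<Longrightarrow> stuffle F \<alpha> \<beta> = stuffle G \<alpha> \<beta>"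
  unfolding stuffle_def using stuffle_shift_cong[of \<alpha> \<beta> F G 0] by auto

text \<open>
  In closed form this is \<open>\<Sum> x\<^bsup>|\<beta>|\<^esup> F \<gamma>\<close> over the factorizations \<open>\<alpha> = \<beta>\<gamma>\<close> with \<open>\<beta>\<close> nonempty: the variable \<open>x\<close>
  absorbs a nonempty prefix of the word.
\<close>
fun prefix_sum :: "'a::comm_ring_1 \<Rightarrow> (nat list \<Rightarrow> 'a) \<Rightarrow> nat list \<Rightarrow> 'a" where
  "prefix_sum x F [] = 0"
| "prefix_sum x F (a # \<alpha>) = x ^ a * (F \<alpha> + prefix_sum x F \<alpha>)"

text \<open>
  The addition theorem for one new variable.  With \<open>G = prefix_sum x F\<close>, the right-hand side at
  \<open>s = 0\<close> is what makes \<open>F + 2G\<close> multiplicative: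
  \<open>(F \<alpha> + 2 G \<alpha>)(F \<beta> + 2 G \<beta>) = F \<alpha> F \<beta> + 2(G \<alpha> F \<beta> + F \<alpha> G \<beta> + 2 G \<alpha> G \<beta>)\<close>.
\<close>
lemma stuffle_shift_prefix_sum:
  fixes F :: "nat list \<Rightarrow> 'a::comm_ring_1"
  assumes F: "\<And>\<alpha> \<beta>. F \<alpha> * F \<beta> = stuffle F \<alpha> \<beta>"
  shows "stuffle_shift (prefix_sum x F) s \<alpha> \<beta> =
    x ^ s * (prefix_sum x F \<alpha> * F \<beta> + F \<alpha> * prefix_sum x F \<beta> + 2 * prefix_sum x F \<alpha> * prefix_sum x F \<beta>)"
proof (induction "length \<alpha> + length \<beta>" arbitrary: s \<alpha> \<beta> rule: less_induct)
  case less
  note IH = less.hyps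
  let ?G = "prefix_sum x F"
  \<comment> \<open>multiplicativity makes \<open>F []\<close> a unit for the values of \<open>F\<close>, which need not make it equal to \<open>1\<close>\<close>
  have F_Nil: "F [] * F \<gamma> = F \<gamma>" for \<gamma>
    by (cases \<gamma>) (simp_all add: F stuffle_def)
  have G_Nil: "F [] * ?G \<gamma> = ?G \<gamma>" for \<gamma>
    by (induction \<gamma>) (simp_all add: mult.left_commute[of "F []"] distrib_left F_Nil)
  have G_add: "?G ((s + a) # \<gamma>) = x ^ s * ?G (a # \<gamma>)" for a \<gamma>
    by (simp add: power_add mult.assoc)
  have Cons: "stuffle_shift (\<lambda>w. ?G (c # w)) 0 \<gamma> \<delta> =
      x ^ c * (F \<gamma> * F \<delta> + (?G \<gamma> * F \<delta> + F \<gamma> * ?G \<delta> + 2 * ?G \<gamma> * ?G \<delta>))"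
    if "\<gamma> \<noteq> [] \<or> \<delta> \<noteq> []" "length \<gamma> + length \<delta> < length \<alpha> + length \<beta>" for c \<gamma> \<delta>
  proof -
    have "stuffle_shift (\<lambda>w. ?G (c # w)) 0 \<gamma> \<delta> = x ^ c * (stuffle_shift F 0 \<gamma> \<delta> + stuffle_shift ?G 0 \<gamma> \<delta>)"
      by (simp add: stuffle_shift_additive[where L = "(*) (x ^ c)"] stuffle_shift_add distrib_left)
    also have "stuffle_shift F 0 \<gamma> \<delta> = F \<gamma> * F \<delta>"
      using that by (auto simp: F stuffle_def)
    finally show ?thesis using IH[OF that(2), of 0] by simp
  qed
  show ?case
  proof (cases \<alpha>; cases \<beta>)
    fix a \<alpha>' b \<beta>' assume eq: "\<alpha> = a # \<alpha>'" "\<beta> = b # \<beta>'"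
    \<comment> \<open>\<open>1\<close>, \<open>2\<close>, \<open>3\<close> evaluate the three terms of the recursion; in the first two the increased letter
      has already been split off, leaving an ordinary product of \<open>F + G\<close>\<close>
    have 1: "stuffle_shift (\<lambda>w. ?G ((s + a) # w)) 0 \<alpha>' \<beta> =
        x ^ (s + a) * (F \<alpha>' * F \<beta> + (?G \<alpha>' * F \<beta> + F \<alpha>' * ?G \<beta> + 2 * ?G \<alpha>' * ?G \<beta>))"
      by (rule Cons) (simp_all add: eq)
    have 2: "stuffle_shift (\<lambda>w. ?G ((s + b) # w)) 0 \<alpha> \<beta>' =
        x ^ (s + b) * (F \<alpha> * F \<beta>' + (?G \<alpha> * F \<beta>' + F \<alpha> * ?G \<beta>' + 2 * ?G \<alpha> * ?G \<beta>'))"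
      by (rule Cons) (simp_all add: eq)
    have 3: "stuffle_shift ?G (s + a + b) \<alpha>' \<beta>' =
        x ^ (s + a + b) * (?G \<alpha>' * F \<beta>' + F \<alpha>' * ?G \<beta>' + 2 * ?G \<alpha>' * ?G \<beta>')"
      by (rule IH) (simp add: eq)
    have "stuffle_shift ?G s \<alpha> \<beta> = stuffle_shift (\<lambda>w. ?G ((s + a) # w)) 0 \<alpha>' \<beta> +
        stuffle_shift (\<lambda>w. ?G ((s + b) # w)) 0 \<alpha> \<beta>' - stuffle_shift ?G (s + a + b) \<alpha>' \<beta>'"
      by (simp only: eq stuffle_shift.simps)
    moreover have "?G \<alpha> = x ^ a * (F \<alpha>' + ?G \<alpha>')" "?G \<beta> = x ^ b * (F \<beta>' + ?G \<beta>')"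
      by (simp_all add: eq)
    ultimately show ?thesis
      unfolding 1 2 3 by (simp add: power_add algebra_simps)
  qed (simp_all add: G_add G_Nil mult.commute[of _ "F []"] del: prefix_sum.simps(2))
qed

text \<open>
  The value of \<open>M\<^sub>\<alpha>\<close> when the variables are specialized to the entries of a list and then to \<open>0\<close>; the recursion
  asks whether the first variable is used.
\<close>
fun M_eval :: "'a::comm_ring_1 list \<Rightarrow> nat list \<Rightarrow> 'a" where
  "M_eval xs [] = 1"
| "M_eval [] (a # \<alpha>) = 0"
| "M_eval (x # xs) (a # \<alpha>) = M_eval xs (a # \<alpha>) + x ^ a * M_eval xs \<alpha>"

definition eta_eval :: "'a::comm_ring_1 list \<Rightarrow> nat list \<Rightarrow> 'a" where
  "eta_eval xs = coarsening_sum (\<lambda>\<beta>. 2 ^ length \<beta> * M_eval xs \<beta>)"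

lemma coarsening_sum_prefix_sum:
  fixes p :: "nat list \<Rightarrow> 'a::comm_ring_1"
  shows "coarsening_sum (\<lambda>\<beta>. case \<beta> of [] \<Rightarrow> 0 | c # \<gamma> \<Rightarrow> x ^ c * p \<gamma>) \<alpha> =
    prefix_sum x (coarsening_sum p) \<alpha>"
proof (induction \<alpha> rule: length_induct)
  case (1 \<alpha>)
  show ?case
  proof (cases \<alpha> rule: remdups_adj.cases)
    case (3 a b \<gamma>)
    have "coarsening_sum (\<lambda>\<beta>. x ^ a * p \<beta>) (b # \<gamma>) = x ^ a * coarsening_sum p (b # \<gamma>)"
      by (rule coarsening_sum_additive[symmetric]) (rule distrib_left)
    then show ?thesis
      using 1[rule_format, of "(a + b) # \<gamma>"] 3 by (simp add: power_add distrib_left mult.assoc)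
  qed auto
qed

text \<open>
  The coefficient \<open>2\<close> is the single-variable part of \<open>\<eta>\<close>: whatever nonempty prefix the variable \<open>x\<close> absorbs,
  it becomes a single letter of the coarsening and hence contributes one factor \<open>2\<close>.
\<close>
lemma eta_eval_Cons: "eta_eval (x # xs) \<alpha> = eta_eval xs \<alpha> + 2 * prefix_sum x (eta_eval xs) \<alpha>"
proof -
  let ?p = "\<lambda>\<beta>. 2 ^ length \<beta> * M_eval xs \<beta>"
  have "2 ^ length \<beta> * M_eval (x # xs) \<beta> =
      ?p \<beta> + 2 * (case \<beta> of [] \<Rightarrow> 0 | c # \<gamma> \<Rightarrow> x ^ c * ?p \<gamma>)" for \<beta>
    by (cases \<beta>) (simp_all add: algebra_simps)
  moreover have "coarsening_sum (\<lambda>\<beta>. 2 * (case \<beta> of [] \<Rightarrow> 0 | c # \<gamma> \<Rightarrow> x ^ c * ?p \<gamma>)) \<alpha> =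
      2 * coarsening_sum (\<lambda>\<beta>. case \<beta> of [] \<Rightarrow> 0 | c # \<gamma> \<Rightarrow> x ^ c * ?p \<gamma>) \<alpha>"
    by (rule coarsening_sum_additive[symmetric]) (rule distrib_left)
  ultimately show ?thesis
    unfolding eta_eval_def coarsening_sum_prefix_sum[symmetric] by (simp only: coarsening_sum_add)
qed

lemma stuffle_shift_eq_0: "(\<And>c w. F (c # w) = 0) \<Longrightarrow> stuffle_shift F s \<alpha> \<beta> = 0"
  by (induction F s \<alpha> \<beta> rule: stuffle_shift.induct) simp_all

lemma eta_eval_mult: "eta_eval xs \<alpha> * eta_eval xs \<beta> = stuffle (eta_eval xs) \<alpha> \<beta>"
proof (induction xs arbitrary: \<alpha> \<beta>)
  case Nil
  have Nil_Cons: "eta_eval ([] :: 'a list) (a # \<alpha>) = 0" for a \<alpha>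
  proof -
    have "eta_eval ([] :: 'a list) (a # \<alpha>) = coarsening_sum (\<lambda>_. 0) (a # \<alpha>)"
      unfolding eta_eval_def by (rule coarsening_sum_Cons_cong) simp
    also have "\<dots> = 0" using coarsening_sum_additive[of "\<lambda>_. 0::'a"] by simp
    finally show ?thesis .
  qed
  show ?case
  proof (cases "\<alpha> = [] \<and> \<beta> = []")
    case True
    then show ?thesis by (simp add: stuffle_def eta_eval_def)
  next
    case False
    then have "eta_eval ([] :: 'a list) \<alpha> * eta_eval [] \<beta> = 0"
      by (cases \<alpha>; cases \<beta>) (simp_all add: Nil_Cons)
    moreover have "stuffle_shift (eta_eval ([] :: 'a list)) 0 \<alpha> \<beta> = 0"
      by (rule stuffle_shift_eq_0) (rule Nil_Cons)
    ultimately show ?thesis using False by (simp only: stuffle_def if_False)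
  qed
next
  case (Cons x xs)
  let ?F = "eta_eval xs" and ?G = "prefix_sum x (eta_eval xs)"
  have "stuffle_shift (eta_eval (x # xs)) 0 \<alpha> \<beta> = stuffle_shift ?F 0 \<alpha> \<beta> + 2 * stuffle_shift ?G 0 \<alpha> \<beta>"
    unfolding eta_eval_Cons
    by (simp add: stuffle_shift_add stuffle_shift_additive[where L = "(*) 2"] distrib_left)
  also have "stuffle_shift ?G 0 \<alpha> \<beta> = ?G \<alpha> * ?F \<beta> + ?F \<alpha> * ?G \<beta> + 2 * ?G \<alpha> * ?G \<beta>"
    using stuffle_shift_prefix_sum[OF Cons] by simp
  finally show ?case
    using Cons[of \<alpha> \<beta>] by (auto simp: stuffle_def eta_eval_Cons algebra_simps)
qed


section \<open>Truncation to finitely many variables\<close>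

text \<open>
  Truncation sets the variables from index \<open>N\<close> on to zero.
\<close>
definition truncate :: "nat \<Rightarrow> 'k::comm_ring_1 mfps \<Rightarrow> 'k mfps" where
  "truncate N f = Abs_mfps (\<lambda>m. if Poly_Mapping.keys m \<subseteq> {..<N} then mcoeff f m else 0)"

lemma mcoeff_truncate [simp]:
  "mcoeff (truncate N f) m = (if Poly_Mapping.keys m \<subseteq> {..<N} then mcoeff f m else 0)"
  by (simp add: truncate_def)

lemma truncate_add: "truncate N (f + g) = truncate N f + truncate N g"
  by (rule mfps_eqI) simp

lemma keys_add_nat:
  fixes p q :: "nat \<Rightarrow>\<^sub>0 nat"
  shows "Poly_Mapping.keys (p + q) = Poly_Mapping.keys p \<union> Poly_Mapping.keys q"
  by (auto simp: in_keys_iff lookup_add)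

lemma truncate_mult: "truncate N (f * g) = truncate N f * truncate N g"
proof (rule mfps_eqI)
  fix m
  show "mcoeff (truncate N (f * g)) m = mcoeff (truncate N f * truncate N g) m"
  proof (cases "Poly_Mapping.keys m \<subseteq> {..<N}")
    case True
    then show ?thesis
      by (auto simp: times_mfps_def splits_def keys_add_nat intro!: sum.cong)
  next
    case False
    then have "(\<Sum>(p, q)\<in>splits m. mcoeff (truncate N f) p * mcoeff (truncate N g) q) = 0"
      by (intro sum.neutral) (auto simp: splits_def keys_add_nat)
    then show ?thesis using False by (simp add: times_mfps_def)
  qed
qed

lemma truncate_eqI:
  assumes "\<And>N. truncate N f = truncate N g"
  shows "f = g"
proof (rule mfps_eqI)
  fix m :: "nat \<Rightarrow>\<^sub>0 nat"
  obtain N where "Poly_Mapping.keys m \<subseteq> {..<N}"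
    using finite_nat_set_iff_bounded[of "Poly_Mapping.keys m"] by auto
  then show "mcoeff f m = mcoeff g m"
    using arg_cong[OF assms[of N], of "\<lambda>h. mcoeff h m"] by simp
qed

definition mono_series :: "(nat \<Rightarrow>\<^sub>0 nat) \<Rightarrow> 'k::comm_ring_1 mfps" where
  "mono_series m = Abs_mfps (\<lambda>m'. if m' = m then 1 else 0)"

abbreviation var :: "nat \<Rightarrow> 'k::comm_ring_1 mfps" where
  "var i \<equiv> mono_series (Poly_Mapping.single i 1)"

lemma mono_series_0: "mono_series 0 = 1"
  by (simp add: mono_series_def one_mfps_def)

lemma mono_series_add: "mono_series (p + q) = mono_series p * mono_series q"
proof (rule mfps_eqI)
  fix m
  have "mcoeff (mono_series p * mono_series q :: 'a mfps) m =
      (\<Sum>x\<in>splits m. if x = (p, q) then 1 else 0)"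
    unfolding times_mfps_def mcoeff_Abs by (rule sum.cong) (auto simp: mono_series_def split: if_splits)
  also have "\<dots> = (if (p, q) \<in> splits m then 1 else 0)"
    by (simp only: sum.delta' sum.delta finite_splits)
  also have "\<dots> = mcoeff (mono_series (p + q)) m"
    by (auto simp: mono_series_def splits_def)
  finally show "mcoeff (mono_series (p + q)) m = mcoeff (mono_series p * mono_series q :: 'a mfps) m"
    by (rule sym)
qed

lemma mono_series_single: "mono_series (Poly_Mapping.single i a) = var i ^ a"
proof (induction a)
  case (Suc a)
  have "Poly_Mapping.single i (Suc a) = Poly_Mapping.single i 1 + Poly_Mapping.single i a"
    by (simp add: single_add[symmetric])
  then show ?case using Suc by (simp add: mono_series_add)
qed (simp add: mono_series_0)

lemma monomial_Cons: "monomial (i # is) (a # \<alpha>) = Poly_Mapping.single i a + monomial is \<alpha>"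
  by (simp add: monomial_def sum.lessThan_Suc_shift del: sum.lessThan_Suc)

text \<open>
  The index tuples of the truncation of \<open>M\<^sub>\<alpha>\<close> to the variables from \<open>i\<close> on, so that the variables can be
  removed one at a time from the front, as in \<open>M_eval\<close>.
\<close>
definition tuples_between :: "nat \<Rightarrow> nat \<Rightarrow> nat \<Rightarrow> nat list set" where
  "tuples_between i N k = {is \<in> increasing_tuples k. set is \<subseteq> {i..<N}}"

lemma finite_tuples_between [simp]: "finite (tuples_between i N k)"
  by (rule finite_subset[OF _ finite_lists_length_eq[of "{i..<N}" k]])
     (auto simp: tuples_between_def increasing_tuples_def)

lemma tuples_between_0: "tuples_between i N 0 = {[]}"
  by (auto simp: tuples_between_def increasing_tuples_def)

lemma tuples_between_empty: "tuples_between N N (Suc k) = {}"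
  by (auto simp: tuples_between_def increasing_tuples_def)

lemma tuples_between_Suc:
  assumes "i < N"
  shows "tuples_between i N (Suc k) =
    tuples_between (Suc i) N (Suc k) \<union> (#) i ` tuples_between (Suc i) N k"
proof (intro equalityI subsetI)
  fix js assume js: "js \<in> tuples_between i N (Suc k)"
  then obtain j "is" where eq: "js = j # is"
    by (auto simp: tuples_between_def increasing_tuples_def length_Suc_conv)
  have "is \<in> increasing_tuples k" "\<forall>x\<in>set is. j < x" "i \<le> j" "\<forall>x\<in>set is. x < N" "j < N"
    using js eq by (auto simp: tuples_between_def increasing_tuples_def)
  then have "is \<in> tuples_between (Suc j) N k"
    by (auto simp: tuples_between_def Suc_le_eq)
  show "js \<in> tuples_between (Suc i) N (Suc k) \<union> (#) i ` tuples_between (Suc i) N k"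
  proof (cases "j = i")
    case True
    then show ?thesis using \<open>is \<in> tuples_between (Suc j) N k\<close> eq by blast
  next
    case False
    then have "Suc i \<le> j" using \<open>i \<le> j\<close> by simp
    moreover have "Suc i \<le> x" if "x \<in> set is" for x
      using \<open>\<forall>x\<in>set is. j < x\<close> \<open>i \<le> j\<close> that by fastforce
    ultimately have "js \<in> tuples_between (Suc i) N (Suc k)"
      using js eq by (auto simp: tuples_between_def)
    then show ?thesis by blast
  qed
next
  fix js assume "js \<in> tuples_between (Suc i) N (Suc k) \<union> (#) i ` tuples_between (Suc i) N k"
  then show "js \<in> tuples_between i N (Suc k)"
    using assms by (auto simp: tuples_between_def increasing_tuples_def Suc_le_eq subset_iff)
qed

lemma sum_tuples_between:
  "i \<le> N \<Longrightarrow> (\<Sum>is\<in>tuples_between i N (length \<alpha>). mono_series (monomial is \<alpha>)) =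
     (M_eval (map var [i..<N]) \<alpha> :: 'k::comm_ring_1 mfps)"
proof (induction i arbitrary: \<alpha> rule: inc_induct)
  case base
  show ?case
    by (cases \<alpha>) (simp_all add: tuples_between_0 tuples_between_empty monomial_def mono_series_0)
next
  case (step i)
  show ?case
  proof (cases \<alpha>)
    case Nil
    then show ?thesis by (simp add: tuples_between_0 monomial_def mono_series_0)
  next
    case (Cons a \<gamma>)
    have disj: "tuples_between (Suc i) N (length \<alpha>) \<inter> (#) i ` tuples_between (Suc i) N (length \<gamma>) = {}"
      by (auto simp: tuples_between_def)
    have "(\<Sum>is\<in>tuples_between i N (length \<alpha>). mono_series (monomial is \<alpha>)) =
        (\<Sum>is\<in>tuples_between (Suc i) N (length \<alpha>). mono_series (monomial is \<alpha>)) +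
        (\<Sum>is\<in>(#) i ` tuples_between (Suc i) N (length \<gamma>). mono_series (monomial is \<alpha>) :: 'k mfps)"
      using tuples_between_Suc[OF step(2), of "length \<gamma>"] Cons disj
      by (simp add: sum.union_disjoint)
    also have "(\<Sum>is\<in>(#) i ` tuples_between (Suc i) N (length \<gamma>). mono_series (monomial is \<alpha>)) =
        var i ^ a * (\<Sum>is\<in>tuples_between (Suc i) N (length \<gamma>). mono_series (monomial is \<gamma>))"
      by (subst sum.reindex)
         (auto simp: Cons monomial_Cons mono_series_add mono_series_single[of i a] sum_distrib_left)
    finally show ?thesis
      using step(2) unfolding step.IH by (simp add: Cons upt_conv_Cons)
  qed
qed

lemma truncate_M:
  assumes "\<alpha> \<in> Comp"
  shows "truncate N (M \<alpha>) = M_eval (map var [0..<N]) \<alpha>"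
proof -
  have "truncate N (M \<alpha>) = (\<Sum>is\<in>tuples_between 0 N (length \<alpha>). mono_series (monomial is \<alpha>) :: 'a mfps)"
  proof (rule mfps_eqI)
    fix m
    let ?T = "tuples_between 0 N (length \<alpha>)"
    have "mcoeff (\<Sum>is\<in>?T. mono_series (monomial is \<alpha>) :: 'a mfps) m =
        (\<Sum>is\<in>?T. if monomial is \<alpha> = m then 1 else 0)"
      by (auto simp: mono_series_def intro!: sum.cong)
    also have "\<dots> = of_nat (card {is \<in> ?T. monomial is \<alpha> = m})"
      by (simp add: sum.If_cases Int_def)
    also have "{is \<in> ?T. monomial is \<alpha> = m} =
        (if Poly_Mapping.keys m \<subseteq> {..<N} then {is \<in> increasing_tuples (length \<alpha>). monomial is \<alpha> = m} else {})"
      using keys_monomial[OF _ assms] by (auto simp: tuples_between_def)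
    finally show "mcoeff (truncate N (M \<alpha>)) m =
        mcoeff (\<Sum>is\<in>?T. mono_series (monomial is \<alpha>) :: 'a mfps) m"
      by (simp add: M_def)
  qed
  then show ?thesis by (simp add: sum_tuples_between)
qed

lemma mfps_scale_2_power: "mfps_scale (2 ^ n) f = 2 ^ n * f"
proof (induction n)
  case (Suc n)
  have "mfps_scale (2 ^ Suc n) f = mfps_scale (2 ^ n) f + mfps_scale (2 ^ n) f"
    by (simp only: power_Suc mult_2 mfps.scale_left_distrib)
  also have "\<dots> = 2 ^ Suc n * f"
    by (simp only: Suc power_Suc mult_2 distrib_right)
  finally show ?case .
qed simp

lemma truncate_eta:
  assumes "\<alpha> \<in> Comp"
  shows "truncate N (eta (1 :: 'k::comm_ring_1) \<alpha>) = eta_eval (map var [0..<N]) \<alpha>"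
proof -
  have "truncate N (eta (1 :: 'k) \<alpha>) =
      coarsening_sum (\<lambda>\<beta>. truncate N (mfps_scale (2 ^ length \<beta>) (M \<beta>))) \<alpha>"
    unfolding eta_eq_coarsening_sum[OF assms]
    by (rule coarsening_sum_additive) (rule truncate_add)
  also have "\<dots> = eta_eval (map var [0..<N]) \<alpha>"
    unfolding eta_eval_def
  proof (rule coarsening_sum_cong[OF assms])
    fix \<beta> assume "\<beta> \<in> Comp"
    have "truncate N (mfps_scale (2 ^ length \<beta>) (M \<beta>)) =
        mfps_scale (2 ^ length \<beta>) (truncate N (M \<beta> :: 'k mfps))"
      by (rule mfps_eqI) simp
    then show "truncate N (mfps_scale (2 ^ length \<beta>) (M \<beta> :: 'k mfps)) =
        2 ^ length \<beta> * M_eval (map var [0..<N]) \<beta>"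
      by (simp only: truncate_M[OF \<open>\<beta> \<in> Comp\<close>] mfps_scale_2_power)
  qed
  finally show ?thesis .
qed

text \<open>
  Multiplicativity can be checked after every truncation, because truncation is a ring homomorphism
  and hence commutes with the expansion on the right-hand side, which has integer coefficients that do not depend
  on the number of variables.
\<close>
lemma eta_mult:
  assumes "\<alpha> \<in> Comp" "\<beta> \<in> Comp"
  shows "eta (1 :: 'k::comm_ring_1) \<alpha> * eta 1 \<beta> = stuffle (eta 1) \<alpha> \<beta>"
proof (rule truncate_eqI)
  fix N
  have additive: "stuffle (\<lambda>w. truncate N (F w)) \<alpha> \<beta> = truncate N (stuffle F \<alpha> \<beta>)"
    for F :: "nat list \<Rightarrow> 'k mfps"
    by (simp add: stuffle_def stuffle_shift_additive truncate_add)
  have "truncate N (eta (1 :: 'k) \<alpha> * eta 1 \<beta>) = stuffle (eta_eval (map var [0..<N])) \<alpha> \<beta>"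
    using assms by (simp add: truncate_mult truncate_eta eta_eval_mult)
  also have "\<dots> = stuffle (\<lambda>w. truncate N (eta 1 w)) \<alpha> \<beta>"
    by (rule stuffle_cong[OF assms]) (simp add: truncate_eta)
  finally show "truncate N (eta (1 :: 'k) \<alpha> * eta 1 \<beta>) = truncate N (stuffle (eta 1) \<alpha> \<beta>)"
    by (simp only: additive)
qed


section \<open>The Hopf subalgebra\<close>

lemma mult_QSym_sub:
  assumes Y: "Y \<subseteq> {1..}" "\<And>y z w. y \<in> Y \<Longrightarrow> z \<in> Y \<Longrightarrow> w \<in> Y \<Longrightarrow> y + z + w \<in> Y"
    and f: "f \<in> QSym_sub (1 :: 'k::comm_ring_1) (lists Y)" and g: "g \<in> QSym_sub 1 (lists Y)"
  shows "f * g \<in> QSym_sub 1 (lists Y)"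
proof -
  let ?D = "QSym_sub (1 :: 'k) (lists Y)"
  have D: "mfps.subspace ?D" by (simp add: QSym_sub_def mfps.subspace_span)
  have T: "lists Y \<subseteq> Comp" using Y(1) by (force simp: Comp_def)
  have left: "mfps.subspace {g. f * g \<in> ?D}" for f
  proof (rule mfps.subspaceI)
    have "f * mfps_scale c g = mfps_scale c (f * g)" for c g
      by (rule mfps_eqI)
         (simp add: times_mfps_def sum_distrib_left case_prod_unfold mult.left_commute)
    then show "mfps_scale c g \<in> {g. f * g \<in> ?D}" if "g \<in> {g. f * g \<in> ?D}" for c g
      using that by (simp add: mfps.subspace_scale[OF D])
  qed (simp_all add: distrib_left mfps.subspace_add[OF D] mfps.subspace_0[OF D])
  have "eta (1 :: 'k) \<alpha> * eta 1 \<beta> \<in> ?D" if "\<alpha> \<in> lists Y" "\<beta> \<in> lists Y" for \<alpha> \<beta>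
  proof -
    have "stuffle (eta (1 :: 'k)) \<alpha> \<beta> \<in> ?D"
      by (rule stuffle_closed[where Y = Y])
         (use that Y(2) eta_in_QSym_sub mfps.subspace_0[OF D] mfps.subspace_add[OF D] mfps.subspace_diff[OF D]
          in blast)+
    then show ?thesis using T that by (subst eta_mult) auto
  qed
  then have "?D \<subseteq> {g. eta (1 :: 'k) \<alpha> * g \<in> ?D}" if "\<alpha> \<in> lists Y" for \<alpha>
    using that by (intro QSym_sub_minimal[OF left]) simp
  then have "?D \<subseteq> {f. g * f \<in> ?D}"
    using g by (intro QSym_sub_minimal[OF left]) (auto simp: mult.commute[of g])
  then show ?thesis using f by (auto simp: mult.commute[of f g])
qed

lemma one_in_QSym_sub:
  assumes "[] \<in> T"
  shows "1 \<in> QSym_sub (1 :: 'k::comm_ring_1) T"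
proof -
  have "increasing_tuples 0 = {[]}" by (auto simp: increasing_tuples_def)
  then have "M [] = (1 :: 'k mfps)"
    by (intro mfps_eqI) (auto simp: M_def one_mfps_def monomial_def)
  then have "eta (1 :: 'k) [] = 1"
    by (simp add: eta_eq_coarsening_sum)
  then show ?thesis
    using eta_in_QSym_sub[OF assms, of "1 :: 'k"] by simp
qed

theorem proposition6p6:
  fixes Y :: "nat set"
  assumes "Y \<subseteq> {1..}"
    and "\<And>y z w. y \<in> Y \<Longrightarrow> z \<in> Y \<Longrightarrow> w \<in> Y \<Longrightarrow> y + z + w \<in> Y"
  shows "hopf_subalgebra (QSym_sub (1 :: 'k::comm_ring_1) (lists Y))"
proof -
  have T: "lists Y \<subseteq> Comp" using assms(1) by (force simp: Comp_def)
  have "subcoalgebra (QSym_sub (1 :: 'k) (lists Y))"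
    by (rule subcoalgebra_QSym_sub[OF T]) simp
  moreover have "antipode f \<in> QSym_sub 1 (lists Y)" if "f \<in> QSym_sub (1 :: 'k) (lists Y)" for f
    by (rule antipode_QSym_sub[OF T _ that]) (simp add: lists_eq_set)
  ultimately show ?thesis
    unfolding hopf_subalgebra_def using mult_QSym_sub[OF assms] one_in_QSym_sub by blast
qed

end
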